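(* Let $d\in\mathbb{N}$, $m>0$, $T>0$, let $\rho_0\colon\mathbb{R}^d\to\mathbb{R}_{>0}$ be a probability density and $\theta_0\colon\mathbb{R}^d\to\mathbb{R}$ an initial phase function. Assume that: (1) the free Madelung problem (see context) with initial data $(\rho_0,\theta_0)$ admits a unique classical solution $(\rho,\theta)\colon\mathbb{R}^d\times[0,T]\to\mathbb{R}_{\ge 0}\times\mathbb{R}$ satisfying $$(\rho,\theta)\in\big[C^1([0,T];C^0_{\mathrm{loc}}(\mathbb{R}^d))\cap C^0([0,T];C^2_{\mathrm{loc}}(\mathbb{R}^d))\big]^2,$$ and $\rho(\cdot,t)$ is a probability density for all $t\in[0,T]$; (2) $\rho(x,t)>0$ for all $(x,t)\in\mathbb{R}^d\times[0,T]$; (3) the hydrodynamic velocity field $\mathbf{v}:=\frac1m\nabla\theta\colon\mathbb{R}^d\times[0,T]\to\mathbb{R}^d$ satisfies, for some constants $L_T,C_T>0$, $$|\mathbf{v}(x,t)-\mathbf{v}(y,t)|\le L_T|x-y|\quad\text{for all }x,y\in\mathbb{R}^d,\ t\in[0,T],$$ $$|\mathbf{v}(x,t)|\le C_T(1+|x|)\quad\text{for all }(x,t)\in\mathbb{R}^d\times[0,T].$$ Then there exists a unique global characteristic flow $X\colon[0,T]\times\mathbb{R}^d\to\mathbb{R}^d$ generated by $\mathbf{v}$, i.e., a unique global solution of $$\partial_tX(t;x)=\mathbf{v}(X(t;x),t)\ \text{ for all }(t,x)\in(0,T)\times\mathbb{R}^d,\qquad X(0;x)=x\ \text{ for all }x\in\mathbb{R}^d,$$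 and, for every $t\in[0,T]$, the map $X(t;\cdot)\colon\mathbb{R}^d\to\mathbb{R}^d$ is a $C^1$-diffeomorphism and $$\rho(\cdot,t)\,\mathrm{d}x=[X(t;\cdot)]_{\#}(\rho_0\,\mathrm{d}x)\quad\text{in }\mathcal{P}(\mathbb{R}^d).$$ Consequently, if $X_0\colon\Xi\to\mathbb{R}^d$ is a random variable on a probability space $(\Xi,\mathcal{F},\mathbb{P})$ satisfying $[X_0]_{\#}\mathbb{P}=\rho_0\,\mathrm{d}x$ in $\mathcal{P}(\mathbb{R}^d)$, then, for every $t\in[0,T]$, the transported random variable $X(t;X_0)\colon\Xi\to\mathbb{R}^d$ satisfies $$[X(t;X_0)]_{\#}\mathbb{P}=\rho(\cdot,t)\,\mathrm{d}x\quad\text{in }\mathcal{P}(\mathbb{R}^d).$$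
   Context: A probability density on $\mathbb{R}^d$ is a function $f\colon\mathbb{R}^d\to\mathbb{R}_{\ge0}$ with $f\in L^1(\mathbb{R}^d)$ and $\|f\|_{L^1(\mathbb{R}^d)}=1$; $f\,\mathrm{d}x$ denotes the Borel probability measure $A\mapsto\int_A f\,\mathrm{d}x$. $\mathcal{P}(\mathbb{R}^d)$ is the set of Borel probability measures on $\mathbb{R}^d$, and $F_{\#}\mu$ denotes the pushforward, $(F_{\#}\mu)(A)=\mu(F^{-1}(A))$. For positive sufficiently regular $\rho$, the Bohm quantum potential (units $\hbar=1$) is $$Q_{\mathrm{B}}(\rho):=-\frac{1}{2m}\frac{\Delta\sqrt{\rho}}{\sqrt{\rho}}.$$ The free Madelung problem with initial data $(\rho_0,\theta_0)$ is $$\partial_t\rho+\tfrac1m\operatorname{div}(\rho\nabla\theta)=0\ \text{ in }\mathbb{R}^d\times(0,T),\qquad \partial_t\theta+\tfrac{1}{2m}|\nabla\theta|^2+Q_{\mathrm{B}}(\rho)=0\ \text{ in }\mathbb{R}^d\times(0,T),$$ $$\rho(\cdot,0)=\rho_0,\qquad\theta(\cdot,0)=\theta_0\ \text{ in }\mathbb{R}^d.$$ Here $\nabla,\operatorname{div},\Delta$ act in the spatial variable. The space $C^k([0,T];C^l_{\mathrm{loc}}(\mathbb{R}^d))$ consists of functions $f$ on $\mathbb{R}^d\times[0,T]$ such that for every compact set (e.g. closed ball) $K\subset\mathbb{R}^d$ the map $t\mapsto f(\cdot,t)|_K$ belongs to $C^k([0,T];C^l(K))$. *)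

theory Defs
  imports "HOL-Probability.Probability"
begin

text \<open>Functions on space-time are curried with time first: \<open>f t x\<close> with \<open>t \<in> {0..T}\<close>;
  values for \<open>t\<close> outside \<open>{0..T}\<close> are irrelevant.\<close>

subsection \<open>Spatial differential operators\<close>

definition partial_deriv ::
    "'a::euclidean_space \<Rightarrow> ('a \<Rightarrow> 'b::real_normed_vector) \<Rightarrow> 'a \<Rightarrow> 'b" where
  "partial_deriv i f x = frechet_derivative f (at x) i"

definition grad :: "('a::euclidean_space \<Rightarrow> real) \<Rightarrow> 'a \<Rightarrow> 'a" where
  "grad f x = (\<Sum>i\<in>Basis. partial_deriv i f x *\<^sub>R i)"

definition divergence :: "('a::euclidean_space \<Rightarrow> 'a) \<Rightarrow> 'a \<Rightarrow> real" where
  "divergence F x = (\<Sum>i\<in>Basis. partial_deriv i (\<lambda>y. F y \<bullet> i) x)"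

definition laplacian :: "('a::euclidean_space \<Rightarrow> real) \<Rightarrow> 'a \<Rightarrow> real" where
  "laplacian f x = (\<Sum>i\<in>Basis. partial_deriv i (partial_deriv i f) x)"


subsection \<open>The spaces \<open>C\<^sup>k([0,T]; C\<^sup>l\<^sub>l\<^sub>o\<^sub>c)\<close>\<close>

primrec C_space :: "nat \<Rightarrow> ('a::euclidean_space \<Rightarrow> 'b::real_normed_vector) \<Rightarrow> bool" where
  "C_space 0 f \<longleftrightarrow> continuous_on UNIV f"
| "C_space (Suc l) f \<longleftrightarrow>
     f differentiable_on UNIV \<and> (\<forall>i\<in>Basis. C_space l (partial_deriv i f))"

text \<open>Convergence in the norm of \<open>C\<^sup>l(K)\<close> for every compact \<open>K\<close>, i.e. uniform convergence on
  \<open>K\<close> of all partial derivatives of order at most \<open>l\<close>. It is only used for functions that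
  are \<open>C\<^sup>l\<close> on the whole space, so the derivatives on \<open>K\<close> are those of the ambient function.\<close>

primrec C_loc_converges ::
    "nat \<Rightarrow> ('t \<Rightarrow> 'a::euclidean_space \<Rightarrow> 'b::real_normed_vector) \<Rightarrow> ('a \<Rightarrow> 'b) \<Rightarrow>
      't filter \<Rightarrow> bool" where
  "C_loc_converges 0 f g F \<longleftrightarrow> (\<forall>K. compact K \<longrightarrow> uniform_limit K f g F)"
| "C_loc_converges (Suc l) f g F \<longleftrightarrow>
     (\<forall>K. compact K \<longrightarrow> uniform_limit K f g F) \<and>
     (\<forall>i\<in>Basis. C_loc_converges l (\<lambda>s. partial_deriv i (f s)) (partial_deriv i g) F)"

text \<open>\<open>C_time_space k l T f\<close> is membership in \<open>C\<^sup>k([0,T]; C\<^sup>l\<^sub>l\<^sub>o\<^sub>c)\<close>. Time derivatives are limits of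
  difference quotients in \<open>C\<^sup>l(K)\<close>, one-sided at the end points of \<open>{0..T}\<close>.\<close>

primrec C_time_space ::
    "nat \<Rightarrow> nat \<Rightarrow> real \<Rightarrow> (real \<Rightarrow> 'a::euclidean_space \<Rightarrow> 'b::real_normed_vector) \<Rightarrow> bool" where
  "C_time_space 0 l T f \<longleftrightarrow>
     (\<forall>t\<in>{0..T}. C_space l (f t) \<and> C_loc_converges l f (f t) (at t within {0..T}))"
| "C_time_space (Suc k) l T f \<longleftrightarrow>
     (\<forall>t\<in>{0..T}. C_space l (f t)) \<and>
     (\<exists>g. C_time_space k l T g \<and>
       (\<forall>t\<in>{0..T}. C_loc_converges l (\<lambda>s x. (f s x - f t x) /\<^sub>R (s - t)) (g t)
          (at t within {0..T})))"


subsection \<open>Probability densities\<close>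

definition prob_density :: "('a::euclidean_space \<Rightarrow> real) \<Rightarrow> bool" where
  "prob_density f \<longleftrightarrow>
     (\<forall>x. 0 \<le> f x) \<and> integrable lborel f \<and> (\<integral>x. \<bar>f x\<bar> \<partial>lborel) = 1"

definition density_measure :: "('a::euclidean_space \<Rightarrow> real) \<Rightarrow> 'a measure" where
  "density_measure f = density lborel (\<lambda>x. ennreal (f x))"


subsection \<open>The free Madelung problem\<close>

definition bohm_potential :: "real \<Rightarrow> ('a::euclidean_space \<Rightarrow> real) \<Rightarrow> 'a \<Rightarrow> real" where
  "bohm_potential m f x = - (1 / (2 * m)) * (laplacian (\<lambda>y. sqrt (f y)) x / sqrt (f x))"

text \<open>The Bohm potential is only meaningful for positive densities, so solving the equations
  on \<open>(0,T)\<close> includes positivity of \<open>\<rho>\<close> there; otherwise the convention \<open>x / 0 = 0\<close> would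
  admit spurious solutions at points where \<open>\<rho>\<close> vanishes.\<close>

definition madelung_equations ::
    "real \<Rightarrow> real \<Rightarrow> (real \<Rightarrow> 'a::euclidean_space \<Rightarrow> real) \<Rightarrow> (real \<Rightarrow> 'a \<Rightarrow> real) \<Rightarrow> bool" where
  "madelung_equations m T \<rho> \<theta> \<longleftrightarrow>
     (\<forall>t\<in>{0<..<T}. \<forall>x.
        0 < \<rho> t x \<and>
        deriv (\<lambda>s. \<rho> s x) t + (1 / m) * divergence (\<lambda>y. \<rho> t y *\<^sub>R grad (\<theta> t) y) x = 0 \<and>
        deriv (\<lambda>s. \<theta> s x) t + (1 / (2 * m)) * (norm (grad (\<theta> t) x))\<^sup>2
          + bohm_potential m (\<rho> t) x = 0)"

definition classical_madelung_solution ::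
    "real \<Rightarrow> real \<Rightarrow> ('a::euclidean_space \<Rightarrow> real) \<Rightarrow> ('a \<Rightarrow> real) \<Rightarrow>
      (real \<Rightarrow> 'a \<Rightarrow> real) \<Rightarrow> (real \<Rightarrow> 'a \<Rightarrow> real) \<Rightarrow> bool" where
  "classical_madelung_solution m T \<rho>0 \<theta>0 \<rho> \<theta> \<longleftrightarrow>
     C_time_space 1 0 T \<rho> \<and> C_time_space 0 2 T \<rho> \<and>
     C_time_space 1 0 T \<theta> \<and> C_time_space 0 2 T \<theta> \<and>
     (\<forall>t\<in>{0..T}. prob_density (\<rho> t)) \<and>
     madelung_equations m T \<rho> \<theta> \<and>
     (\<forall>x. \<rho> 0 x = \<rho>0 x) \<and> (\<forall>x. \<theta> 0 x = \<theta>0 x)"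

definition unique_classical_madelung_solution ::
    "real \<Rightarrow> real \<Rightarrow> ('a::euclidean_space \<Rightarrow> real) \<Rightarrow> ('a \<Rightarrow> real) \<Rightarrow>
      (real \<Rightarrow> 'a \<Rightarrow> real) \<Rightarrow> (real \<Rightarrow> 'a \<Rightarrow> real) \<Rightarrow> bool" where
  "unique_classical_madelung_solution m T \<rho>0 \<theta>0 \<rho> \<theta> \<longleftrightarrow>
     classical_madelung_solution m T \<rho>0 \<theta>0 \<rho> \<theta> \<and>
     (\<forall>\<rho>' \<theta>'. classical_madelung_solution m T \<rho>0 \<theta>0 \<rho>' \<theta>' \<longrightarrow>
        (\<forall>t\<in>{0..T}. \<forall>x. \<rho>' t x = \<rho> t x \<and> \<theta>' t x = \<theta> t x))"

definition velocity :: "real \<Rightarrow> (real \<Rightarrow> 'a::euclidean_space \<Rightarrow> real) \<Rightarrow> real \<Rightarrow> 'a \<Rightarrow> 'a" where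
  "velocity m \<theta> t x = (1 / m) *\<^sub>R grad (\<theta> t) x"


subsection \<open>Characteristic flows\<close>

text \<open>The differential equation is imposed on the open interval only; continuity up to the end
  points ties the trajectories to their initial values.\<close>

definition characteristic_flow ::
    "real \<Rightarrow> (real \<Rightarrow> 'a::euclidean_space \<Rightarrow> 'a) \<Rightarrow> (real \<Rightarrow> 'a \<Rightarrow> 'a) \<Rightarrow> bool" where
  "characteristic_flow T v X \<longleftrightarrow>
     (\<forall>x. continuous_on {0..T} (\<lambda>t. X t x)) \<and>
     (\<forall>t\<in>{0<..<T}. \<forall>x. ((\<lambda>s. X s x) has_vector_derivative v t (X t x)) (at t)) \<and>
     (\<forall>x. X 0 x = x)"

definition C1_diffeomorphism :: "('a::euclidean_space \<Rightarrow> 'a) \<Rightarrow> bool" where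
  "C1_diffeomorphism F \<longleftrightarrow> bij F \<and> C_space 1 F \<and> C_space 1 (inv F)"

end

theory Submission
  imports Defs
begin

text \<open>
  Along a characteristic \<open>X(t; x)\<close> the continuity equation reads
  \<open>d/dt \<rho>(t, X) = - \<rho>(t, X) div v(t, X)\<close>, while Liouville's formula gives
  \<open>d/dt det DX = div v(t, X) det DX\<close>. Hence \<open>\<rho>(t, X(t; x)) det DX(t; x)\<close> is constant in \<open>t\<close>
  and equal to \<open>\<rho>\<^sub>0(x)\<close>, which is the push-forward identity by the change of variables formula.
  The flow itself comes from a Picard iteration on the whole of \<open>[0, T]\<close>; its derivative in \<open>x\<close> is the
  flow of the variational equation (a Gronwall estimate), and its inverse at time \<open>S\<close> is the flow
  of the time-reversed field \<open>- v(S - t, x)\<close>, so regularity of the inverse needs no further argument.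
\<close>

section \<open>Flows of Lipschitz fields\<close>

text \<open>The global Lipschitz constant does three jobs: it lets the fixed point argument cover
  \<open>{0..T}\<close> in one step, it bounds the spatial derivative of the field, and it thereby
  makes the variational equation a Lipschitz equation with the same constant. Existence, uniqueness
  and Gronwall bounds, proved once in \<open>lipschitz_field\<close>, therefore serve the flow, its
  derivative and the reversed flow alike. The delicate points are regularity in time and the end
  points. Joint differentiability of \<open>\<rho>\<close> is bypassed: its total derivative along a
  trajectory exists because the difference quotients in time converge locally uniformly in space.
  The equations hold only for 0 < t < T, so identities are derived inside the interval and carried
  to its ends by continuity. The reversed field at time S lives on \<open>{0..S}\<close>, which is
  why every flow carries the length of its time interval as a parameter.\<close>

lemma gronwall_integral:
  fixes u :: "real \<Rightarrow> real"
  assumes cont: "continuous_on {0..T} u" and "a \<ge> 0"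
    and le: "\<And>t. t \<in> {0..T} \<Longrightarrow> u t \<le> C + a * integral {0..t} u"
    and t: "t \<in> {0..T}"
  shows "u t \<le> C * exp (a * t)"
proof -
  define U where "U = (\<lambda>t. integral {0..t} u)"
  \<comment> \<open>The integrating factor turns the integral inequality into
    \<open>G' \<le> 0\<close>.\<close>
  define G where "G = (\<lambda>t. exp (- a * t) * (C + a * U t))"
  have dU: "(U has_real_derivative u s) (at s within {0..T})" if "s \<in> {0..T}" for s
    unfolding U_def using integral_has_real_derivative[OF cont that] .
  have dG: "(G has_real_derivative exp (- a * s) * (a * (u s - (C + a * U s)))) (at s within {0..T})"
    if "s \<in> {0..T}" for s
    unfolding G_def by (auto intro!: derivative_eq_intros dU that simp: algebra_simps)
  have contG: "continuous_on {0..T} G"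
    by (rule DERIV_continuous_on) (rule dG)
  have "G t \<le> G 0"
  proof (rule DERIV_nonpos_imp_decreasing_open[of 0 t G])
    show "0 \<le> t" using t by simp
    show "continuous_on {0..t} G"
      using contG t by (auto intro: continuous_on_subset)
    fix s assume s: "0 < s" "s < t"
    have "at s within {0..T} = at s"
      using s t by (intro at_within_interior) auto
    then have "DERIV G s :> exp (- a * s) * (a * (u s - (C + a * U s)))"
      using dG[of s] s t by auto
    moreover have "exp (- a * s) * (a * (u s - (C + a * U s))) \<le> 0"
      using le[of s] s t \<open>a \<ge> 0\<close> unfolding U_def
      by (intro mult_nonneg_nonpos) (auto intro!: mult_nonneg_nonpos)
    ultimately show "\<exists>y. DERIV G s :> y \<and> y \<le> 0" by blast
  qed
  also have "G 0 = C" by (simp add: G_def U_def)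
  finally have "G t * exp (a * t) \<le> C * exp (a * t)"
    by (intro mult_right_mono) auto
  moreover have "G t * exp (a * t) = C + a * U t"
    by (simp add: G_def exp_minus field_simps)
  ultimately show ?thesis using le[OF t] unfolding U_def by linarith
qed

lemma has_vector_derivative_imp_continuous_on:
  assumes "\<And>t. t \<in> S \<Longrightarrow> (f has_vector_derivative g t) (at t within S)"
  shows "continuous_on S f"
  using assms by (meson continuous_on_eq_continuous_within has_vector_derivative_continuous)

text \<open>The norm need not be differentiable at 0, so the estimate passes through the integral
  form. Dependence on initial values uses b = 0; in the differentiability proofs b is a small
  linearisation error. The bound contains T instead of t so that one constant serves all
  times.\<close>

lemma gronwall_norm:
  fixes f g :: "real \<Rightarrow> 'a::euclidean_space"
  assumes der: "\<And>t. t \<in> {0..T} \<Longrightarrow> (f has_vector_derivative g t) (at t within {0..T})"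
    and "continuous_on {0..T} g"
    and bound: "\<And>t. t \<in> {0..T} \<Longrightarrow> norm (g t) \<le> a * norm (f t) + b"
    and "a \<ge> 0" "b \<ge> 0" and t: "t \<in> {0..T}"
  shows "norm (f t) \<le> (norm (f 0) + b * T) * exp (a * T)"
proof -
  have contf: "continuous_on {0..T} f"
    using der by (rule has_vector_derivative_imp_continuous_on)
  have "norm (f t) \<le> (norm (f 0) + b * T) * exp (a * t)"
  proof (rule gronwall_integral[OF _ \<open>a \<ge> 0\<close> _ t])
    show "continuous_on {0..T} (\<lambda>t. norm (f t))" by (intro continuous_intros contf)
    fix s assume s: "s \<in> {0..T}"
    have sub: "{0..s} \<subseteq> {0..T}" using s by auto
    have "(g has_integral (f s - f 0)) {0..s}"
      using s sub by (intro fundamental_theorem_of_calculus)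
        (auto intro: has_vector_derivative_within_subset[OF der])
    then have "norm (f s - f 0) = norm (integral {0..s} g)" by (simp add: integral_unique)
    also have "\<dots> \<le> integral {0..s} (\<lambda>r. a * norm (f r) + b)"
      using sub bound
      by (intro integral_norm_bound_integral integrable_continuous_real continuous_intros)
        (auto intro: continuous_on_subset[OF contf] continuous_on_subset[OF assms(2)])
    also have "\<dots> = a * integral {0..s} (\<lambda>r. norm (f r)) + b * s"
    proof -
      have "(\<lambda>r. norm (f r)) integrable_on {0..s}"
        using sub by (intro integrable_continuous_real continuous_intros)
          (auto intro: continuous_on_subset[OF contf])
      then show ?thesis using s
        by (subst integral_add) (auto intro: integrable_on_mult_right)
    qed
    also have "b * s \<le> b * T" using s \<open>b \<ge> 0\<close> by (simp add: mult_left_mono)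
    finally show "norm (f s) \<le> (norm (f 0) + b * T) + a * integral {0..s} (\<lambda>r. norm (f r))"
      using norm_triangle_ineq2[of "f s" "f 0"] by linarith
  qed
  also have "\<dots> \<le> (norm (f 0) + b * T) * exp (a * T)"
    using t \<open>a \<ge> 0\<close> \<open>b \<ge> 0\<close> by (intro mult_left_mono) (auto simp: mult_left_mono)
  finally show ?thesis .
qed

text \<open>One-sided derivatives at both ends make the notion stable under restriction to
  \<open>{0..S}\<close> and under time reversal; \<open>characteristic_flow_iff\<close> relates it
  to the formulation on the open interval.\<close>

definition ode_solution :: "real \<Rightarrow> (real \<Rightarrow> 'a::real_normed_vector \<Rightarrow> 'a) \<Rightarrow> (real \<Rightarrow> 'a) \<Rightarrow> bool" where
  "ode_solution T v X \<longleftrightarrow>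
     (\<forall>t\<in>{0..T}. (X has_vector_derivative v t (X t)) (at t within {0..T}))"

text \<open>For a Lipschitz field the choice is unambiguous on \<open>{0..T}\<close>. Outside that
  interval the value is arbitrary, and flows with different T are compared by
  \<open>flow_restrict\<close>.\<close>

definition ode_flow :: "real \<Rightarrow> (real \<Rightarrow> 'a::real_normed_vector \<Rightarrow> 'a) \<Rightarrow> real \<Rightarrow> 'a \<Rightarrow> 'a" where
  "ode_flow T v t x = (SOME X. ode_solution T v X \<and> X 0 = x) t"

lemma ode_solution_continuous_on: "ode_solution T v X \<Longrightarrow> continuous_on {0..T} X"
  unfolding ode_solution_def
  by (rule has_vector_derivative_imp_continuous_on[where g = "\<lambda>t. v t (X t)"]) auto

lemma ode_solution_subset:
  "ode_solution T v X \<Longrightarrow> S \<le> T \<Longrightarrow> ode_solution S v X"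
  unfolding ode_solution_def
  using has_vector_derivative_within_subset[of X _ _ "{0..T}" "{0..S}"] by simp

lemma ode_solution_reverse:
  assumes "ode_solution T v X"
  shows "ode_solution T (\<lambda>t x. - v (T - t) x) (\<lambda>t. X (T - t))"
  unfolding ode_solution_def
proof
  fix t assume t: "t \<in> {0..T}"
  have img: "(\<lambda>s. T - s) ` {0..T} = {0..T}"
    by simp
  have "(X has_vector_derivative v (T - t) (X (T - t))) (at (T - t) within (\<lambda>s. T - s) ` {0..T})"
    unfolding img using assms t by (auto simp: ode_solution_def)
  moreover have "((\<lambda>s. T - s) has_vector_derivative -1) (at t within {0..T})"
    by (auto intro!: derivative_eq_intros)
  ultimately have "(X \<circ> (\<lambda>s. T - s) has_vector_derivative -1 *\<^sub>R v (T - t) (X (T - t))) (at t within {0..T})"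
    by (intro vector_diff_chain_within)
  then show "((\<lambda>s. X (T - s)) has_vector_derivative - v (T - t) (X (T - t))) (at t within {0..T})"
    by (simp add: o_def)
qed

locale lipschitz_field =
  fixes T L :: real and v :: "real \<Rightarrow> 'a::euclidean_space \<Rightarrow> 'a"
  assumes T_nonneg: "0 \<le> T" and L_nonneg: "0 \<le> L"
    and continuous_field: "continuous_on ({0..T} \<times> UNIV) (\<lambda>(t, x). v t x)"
    and lipschitz: "\<And>t x y. t \<in> {0..T} \<Longrightarrow> norm (v t x - v t y) \<le> L * norm (x - y)"
begin

lemma continuous_on_field_compose:
  assumes "continuous_on S \<tau>" "continuous_on S \<xi>" "\<tau> ` S \<subseteq> {0..T}"
  shows "continuous_on S (\<lambda>s. v (\<tau> s) (\<xi> s))"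
  using continuous_on_compose2[OF continuous_field, of S "\<lambda>s. (\<tau> s, \<xi> s)"] assms
  by (auto intro: continuous_on_Pair)

section \<open>Uniqueness and global existence of solutions\<close>

lemma solution_dist_le:
  assumes X: "ode_solution T v X" and Y: "ode_solution T v Y" and t: "t \<in> {0..T}"
  shows "norm (X t - Y t) \<le> norm (X 0 - Y 0) * exp (L * T)"
proof -
  have "norm (X t - Y t) \<le> (norm (X 0 - Y 0) + 0 * T) * exp (L * T)"
  proof (rule gronwall_norm[OF _ _ _ L_nonneg _ t])
    show "((\<lambda>t. X t - Y t) has_vector_derivative v s (X s) - v s (Y s)) (at s within {0..T})"
      if "s \<in> {0..T}" for s
      using X Y that unfolding ode_solution_def by (auto intro: derivative_intros)
    show "continuous_on {0..T} (\<lambda>t. v t (X t) - v t (Y t))"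
      using X Y by (auto intro!: continuous_intros continuous_on_field_compose
          dest: ode_solution_continuous_on)
  qed (auto simp: lipschitz)
  then show ?thesis by simp
qed

lemma solution_unique:
  assumes "ode_solution T v X" "ode_solution T v Y" "X 0 = Y 0" "t \<in> {0..T}"
  shows "X t = Y t"
  using solution_dist_le[OF assms(1,2,4)] assms(3) by simp

text \<open>The weight \<open>exp (- K t)\<close> makes the Picard operator a contraction on the whole interval.\<close>

lemma solution_exists: "\<exists>X. ode_solution T v X \<and> X 0 = x"
proof -
  \<comment> \<open>The contraction factor will be \<open>L / K\<close>, so \<open>2 * L\<close>
    yields 1/2; the summand 1 keeps K positive when L = 0.\<close>
  define K where "K = 2 * L + 1"
  have K: "K > 0" "L / K \<le> 1/2" using L_nonneg by (auto simp: K_def field_simps)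
  \<comment> \<open>The unknown is \<open>u t = exp (- K * t) X(t)\<close>; \<open>I u\<close> is
    the integral term of the Picard operator written in terms of u.\<close>
  define I where "I = (\<lambda>u :: real \<Rightarrow>\<^sub>C 'a. \<lambda>t. integral {0..t} (\<lambda>s. v s (exp (K * s) *\<^sub>R u s)))"
  define Q where "Q = (\<lambda>u t. exp (- K * t) *\<^sub>R (x + I u t))"
  have cont: "continuous_on {0..T} (\<lambda>s. v s (exp (K * s) *\<^sub>R apply_bcontfun u s))" for u
    by (intro continuous_on_field_compose continuous_intros) auto
  have dI: "(I u has_vector_derivative v t (exp (K * t) *\<^sub>R u t)) (at t within {0..T})"
    if "t \<in> {0..T}" for u t
    unfolding I_def using integral_has_vector_derivative[OF cont that] .
  have contQ: "continuous_on {0..T} (Q u)" for u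
    unfolding Q_def
    by (intro continuous_intros has_vector_derivative_imp_continuous_on[OF dI])
  \<comment> \<open>Banach's theorem needs a complete space: bounded continuous functions on the
    whole line. \<open>clamp\<close> extends \<open>Q u\<close> beyond \<open>{0..T}\<close> by its
    end values.\<close>
  have "\<forall>u. \<exists>w :: real \<Rightarrow>\<^sub>C 'a. \<forall>t. w t = Q u (clamp 0 T t)"
    using contQ by (metis continuous_on_cbox_bcontfunE cbox_interval)
  then obtain P :: "(real \<Rightarrow>\<^sub>C 'a) \<Rightarrow> (real \<Rightarrow>\<^sub>C 'a)" where P: "\<And>u t. P u t = Q u (clamp 0 T t)"
    by metis
  have "dist (P u) (P w) \<le> 1/2 * dist u w" for u w
  proof (rule dist_bound)
    fix t
    define s where "s = clamp 0 T t"
    have s: "s \<in> {0..T}"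
      unfolding s_def using T_nonneg clamp_in_interval[of 0 T t] by auto
    have sub: "{0..s} \<subseteq> {0..T}" using s by auto
    define D where "D = dist u w"
    have "norm (I u s - I w s) =
        norm (integral {0..s} (\<lambda>r. v r (exp (K * r) *\<^sub>R u r) - v r (exp (K * r) *\<^sub>R w r)))"
      unfolding I_def
      by (subst integral_diff)
        (auto intro!: integrable_continuous_real intro: continuous_on_subset[OF cont sub])
    also have "\<dots> \<le> integral {0..s} (\<lambda>r. L * D * exp (K * r))"
    proof (intro integral_norm_bound_integral)
      show "(\<lambda>r. v r (exp (K * r) *\<^sub>R u r) - v r (exp (K * r) *\<^sub>R w r)) integrable_on {0..s}"
        by (intro integrable_continuous_real continuous_intros continuous_on_subset[OF cont sub])
      show "(\<lambda>r. L * D * exp (K * r)) integrable_on {0..s}"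
        by (intro integrable_continuous_real continuous_intros)
      fix r assume "r \<in> {0..s}"
      then have "norm (v r (exp (K * r) *\<^sub>R u r) - v r (exp (K * r) *\<^sub>R w r))
          \<le> L * norm (exp (K * r) *\<^sub>R u r - exp (K * r) *\<^sub>R w r)"
        using sub by (intro lipschitz) auto
      also have "\<dots> = L * (exp (K * r) * dist (u r) (w r))"
        by (simp add: dist_norm flip: scaleR_diff_right)
      also have "\<dots> \<le> L * (exp (K * r) * D)"
        unfolding D_def by (intro mult_left_mono dist_bounded L_nonneg) auto
      finally show "norm (v r (exp (K * r) *\<^sub>R u r) - v r (exp (K * r) *\<^sub>R w r)) \<le> L * D * exp (K * r)"
        by (simp add: mult_ac)
    qed
    also have "\<dots> = L * D * ((exp (K * s) - 1) / K)"
    proof -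
      have "((\<lambda>r. exp (K * r)) has_integral exp (K * s) / K - exp (K * 0) / K) {0..s}"
        using s K(1) by (intro fundamental_theorem_of_calculus)
         (auto intro!: derivative_eq_intros simp flip: has_real_derivative_iff_has_vector_derivative)
      then show ?thesis by (simp add: integral_unique diff_divide_distrib)
    qed
    also have "\<dots> \<le> L * D * (exp (K * s) / K)"
      using K L_nonneg by (intro mult_left_mono divide_right_mono) (auto simp: D_def)
    also have "\<dots> = exp (K * s) * ((L / K) * D)" by simp
    also have "\<dots> \<le> exp (K * s) * (1/2 * D)"
      using K by (intro mult_left_mono mult_right_mono) (auto simp: D_def)
    finally have "exp (- K * s) * norm (I u s - I w s) \<le> exp (- K * s) * (exp (K * s) * (1/2 * D))"
      by (intro mult_left_mono) auto
    then have "exp (- K * s) * norm (I u s - I w s) \<le> 1/2 * D"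
      by (simp add: exp_minus field_simps)
    moreover have "dist (P u t) (P w t) = exp (- K * s) * norm (I u s - I w s)"
      unfolding P Q_def dist_norm s_def[symmetric] by (simp flip: scaleR_diff_right)
    ultimately show "dist (P u t) (P w t) \<le> 1/2 * dist u w" by (simp add: D_def)
  qed
  then obtain u where u: "P u = u"
    using banach_fix_type[of "1/2" P] by auto
  have fixp: "u t = exp (- K * t) *\<^sub>R (x + I u t)" if "t \<in> {0..T}" for t
    using P[of u t] that by (simp add: u Q_def)
  have eq: "exp (K * t) *\<^sub>R u t = x + I u t" if "t \<in> {0..T}" for t
    using fixp[OF that] by (simp add: exp_minus)
  have "ode_solution T v (\<lambda>t. x + I u t)"
    unfolding ode_solution_def
  proof
    fix t assume t: "t \<in> {0..T}"
    show "((\<lambda>t. x + I u t) has_vector_derivative v t (x + I u t)) (at t within {0..T})"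
      using dI[OF t, of u] eq[OF t] by (auto intro!: derivative_eq_intros)
  qed
  moreover have "x + I u 0 = x" by (simp add: I_def)
  ultimately show ?thesis by blast
qed

lemma flow_solution: "ode_solution T v (\<lambda>t. ode_flow T v t x)"
  and flow_0 [simp]: "ode_flow T v 0 x = x"
  using someI_ex[OF solution_exists[of x]] unfolding ode_flow_def by simp_all

lemma flow_unique:
  "ode_solution T v X \<Longrightarrow> t \<in> {0..T} \<Longrightarrow> X t = ode_flow T v t (X 0)"
  by (rule solution_unique[OF _ flow_solution]) auto

lemma flow_dist_le:
  "t \<in> {0..T} \<Longrightarrow> norm (ode_flow T v t x - ode_flow T v t y) \<le> norm (x - y) * exp (L * T)"
  using solution_dist_le[OF flow_solution flow_solution, of t x y] unfolding flow_0 .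

lemma continuous_on_flow: "continuous_on {0..T} (\<lambda>t. ode_flow T v t x)"
  by (rule ode_solution_continuous_on[OF flow_solution])

text \<open>Reversing twice at time S leads back to v, but on \<open>{0..S}\<close> only; this
  identifies the resulting flow with the one on \<open>{0..T}\<close>.\<close>

lemma flow_restrict:
  assumes "S \<in> {0..T}" "t \<in> {0..S}"
  shows "ode_flow S v t x = ode_flow T v t x"
proof -
  interpret restr: lipschitz_field S L v
    using assms(1) L_nonneg lipschitz
    by unfold_locales (auto intro: continuous_on_subset[OF continuous_field])
  show ?thesis
    using restr.flow_unique[OF ode_solution_subset[OF flow_solution] assms(2)] assms by auto
qed

section \<open>Time reversal and the inverse of the flow map\<close>

lemma reverse_field:
  assumes "S \<in> {0..T}"
  shows "lipschitz_field S L (\<lambda>t x. - v (S - t) x)"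
proof
  have "continuous_on ({0..S} \<times> UNIV) (\<lambda>p. v (S - fst p) (snd p))"
    using assms by (intro continuous_on_field_compose continuous_intros) auto
  then show "continuous_on ({0..S} \<times> UNIV) (\<lambda>(t, x). - v (S - t) x)"
    by (auto simp: case_prod_unfold intro: continuous_intros)
  show "norm (- v (S - t) x - - v (S - t) y) \<le> L * norm (x - y)" if "t \<in> {0..S}" for t x y
    using lipschitz[of "S - t" y x] that assms by (simp add: norm_minus_commute)
qed (use assms L_nonneg in auto)

text \<open>Traversed backwards from time S, the trajectory of x solves the reversed equation with
  initial value X(S; x). Uniqueness then forces the reversed flow to return to x.\<close>

lemma reverse_flow:
  assumes S: "S \<in> {0..T}"
  shows "ode_flow S (\<lambda>t x. - v (S - t) x) S (ode_flow T v S x) = x"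
proof -
  interpret rev: lipschitz_field S L "\<lambda>t x. - v (S - t) x" by (rule reverse_field[OF S])
  have "ode_solution S v (\<lambda>t. ode_flow T v t x)"
    using S by (intro ode_solution_subset[OF flow_solution]) auto
  then have "ode_solution S (\<lambda>t x. - v (S - t) x) (\<lambda>t. ode_flow T v (S - t) x)"
    by (rule ode_solution_reverse)
  from rev.flow_unique[OF this, of S] show ?thesis using S by simp
qed

text \<open>This is \<open>reverse_flow\<close> for the reversed field, whose own reversal is v
  again.\<close>

lemma flow_reverse:
  assumes S: "S \<in> {0..T}"
  shows "ode_flow T v S (ode_flow S (\<lambda>t x. - v (S - t) x) S y) = y"
proof -
  interpret rev: lipschitz_field S L "\<lambda>t x. - v (S - t) x" by (rule reverse_field[OF S])
  let ?x = "ode_flow S (\<lambda>t x. - v (S - t) x) S y"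
  have "- (- v (S - (S - t)) x) = v t x" for t x
    by (simp only: minus_minus diff_diff_eq2 add_diff_cancel_left')
  then have twice: "(\<lambda>t x. - (- v (S - (S - t)) x)) = v"
    by (intro ext)
  have S': "S \<in> {0..S}" using S by simp
  have "ode_flow S v S ?x = y"
    using rev.reverse_flow[OF S', of y] unfolding twice .
  then show ?thesis
    unfolding flow_restrict[OF S S', of ?x] .
qed

text \<open>Continuity up to the ends turns the equation on the open interval into the integral
  equation on \<open>{0..T}\<close>. Its integrand is continuous on the closed interval, so the
  one-sided derivatives at the ends come for free.\<close>

lemma characteristic_flow_iff:
  "characteristic_flow T v X \<longleftrightarrow>
     (\<forall>x. ode_solution T v (\<lambda>t. X t x) \<and> X 0 x = x)"
proof -
  have "ode_solution T v Y" if cont: "continuous_on {0..T} Y"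
    and der: "\<And>t. t \<in> {0<..<T} \<Longrightarrow> (Y has_vector_derivative v t (Y t)) (at t)" for Y
    unfolding ode_solution_def
  proof
    fix t assume t: "t \<in> {0..T}"
    have contv: "continuous_on {0..T} (\<lambda>t. v t (Y t))"
      by (rule continuous_on_field_compose[OF continuous_on_id cont]) simp
    have eq: "Y 0 + integral {0..s} (\<lambda>t. v t (Y t)) = Y s" if "s \<in> {0..T}" for s
    proof -
      have "((\<lambda>t. v t (Y t)) has_integral (Y s - Y 0)) {0..s}"
      proof (rule fundamental_theorem_of_calculus_interior)
        show "continuous_on {0..s} Y" using that by (auto intro: continuous_on_subset[OF cont])
        show "(Y has_vector_derivative v t (Y t)) (at t)" if "t \<in> {0<..<s}" for t
          using that \<open>s \<in> {0..T}\<close> by (intro der) auto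
      qed (use that in simp)
      then show ?thesis by (simp add: integral_unique)
    qed
    have "((\<lambda>s. Y 0 + integral {0..s} (\<lambda>t. v t (Y t))) has_vector_derivative v t (Y t)) (at t within {0..T})"
      using integral_has_vector_derivative[OF contv t] by (auto intro!: derivative_eq_intros)
    then show "(Y has_vector_derivative v t (Y t)) (at t within {0..T})"
      by (rule has_vector_derivative_transform[OF t, rotated]) (simp add: eq)
  qed
  moreover have "(Y has_vector_derivative v t (Y t)) (at t)"
    if "ode_solution T v Y" "t \<in> {0<..<T}" for Y t
  proof -
    have "at t within {0..T} = at t" using that by (intro at_within_interior) auto
    then show ?thesis using that by (metis atLeastAtMost_iff greaterThanLessThan_iff less_imp_le ode_solution_def)
  qed
  ultimately show ?thesis
    unfolding characteristic_flow_def using ode_solution_continuous_on by blast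
qed

end

section \<open>Differentiability of the flow\<close>

text \<open>Difference quotients along \<open>s *\<^sub>R h\<close> for small s are bounded by L
  times the norm of h, and the derivative inherits the bound. This makes the variational equation
  Lipschitz with the constant of the field.\<close>

lemma has_derivative_norm_le_lipschitz:
  fixes f :: "'a::real_normed_vector \<Rightarrow> 'b::real_normed_vector"
  assumes der: "(f has_derivative f') (at x)"
    and lip: "\<And>y. norm (f y - f x) \<le> L * norm (y - x)"
  shows "norm (f' h) \<le> L * norm h"
proof (rule field_le_epsilon)
  fix e :: real assume "e > 0"
  define \<epsilon> where "\<epsilon> = e / (norm h + 1)"
  have "\<epsilon> > 0" using \<open>e > 0\<close> by (auto simp: \<epsilon>_def intro!: divide_pos_pos add_nonneg_pos)
  then obtain d where d: "d > 0"
    "\<And>y. norm (y - x) < d \<Longrightarrow> norm (f y - f x - f' (y - x)) \<le> \<epsilon> * norm (y - x)"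
    using der unfolding has_derivative_at_alt by blast
  \<comment> \<open>Small enough that \<open>s *\<^sub>R h\<close> stays in the d-ball; the summand
    1 covers h = 0.\<close>
  define s where "s = d / (2 * (norm h + 1))"
  have s: "s > 0" using d by (auto simp: s_def intro!: divide_pos_pos add_nonneg_pos)
  have "s * (norm h + 1) = d / 2"
    using norm_ge_zero[of h] by (simp add: s_def field_simps add_nonneg_eq_0_iff)
  then have "s * norm h < d" using s d(1) by (simp add: distrib_left)
  then have "norm (f (x + s *\<^sub>R h) - f x - f' (s *\<^sub>R h)) \<le> \<epsilon> * (s * norm h)"
    using d(2)[of "x + s *\<^sub>R h"] s by simp
  moreover have "norm (f (x + s *\<^sub>R h) - f x) \<le> L * (s * norm h)"
    using lip[of "x + s *\<^sub>R h"] s by simp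
  ultimately have "norm (f' (s *\<^sub>R h)) \<le> L * (s * norm h) + \<epsilon> * (s * norm h)"
    using norm_triangle_ineq4[of "f (x + s *\<^sub>R h) - f x" "f (x + s *\<^sub>R h) - f x - f' (s *\<^sub>R h)"]
    by simp
  moreover have "f' (s *\<^sub>R h) = s *\<^sub>R f' h"
    using has_derivative_linear[OF der] by (simp add: linear_cmul)
  ultimately have "s * norm (f' h) \<le> s * (L * norm h + \<epsilon> * norm h)"
    using s by (simp add: algebra_simps)
  then have "norm (f' h) \<le> L * norm h + \<epsilon> * norm h" using s by simp
  also have "\<epsilon> * norm h \<le> e"
    using \<open>e > 0\<close> norm_ge_zero[of h]
    by (simp add: \<epsilon>_def divide_le_eq mult_left_mono add_nonneg_pos)
  finally show "norm (f' h) \<le> L * norm h + e" by simp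
qed

text \<open>Continuity of the derivative is required in basis directions only, where it amounts to
  continuity of the partial derivatives; other directions follow by linearity
  (\<open>derivative_expand\<close>).\<close>

locale C1_field = lipschitz_field T L v
  for T L :: real and v :: "real \<Rightarrow> 'a::euclidean_space \<Rightarrow> 'a" +
  fixes A :: "real \<Rightarrow> 'a \<Rightarrow> 'a \<Rightarrow> 'a"
  assumes field_has_derivative:
      "\<And>t x. t \<in> {0..T} \<Longrightarrow> (v t has_derivative A t x) (at x)"
    and continuous_on_derivative:
      "\<And>h. h \<in> Basis \<Longrightarrow> continuous_on ({0..T} \<times> UNIV) (\<lambda>(t, x). A t x h)"
begin

section \<open>Bounds and uniform continuity of the spatial derivative\<close>

lemma linear_derivative: "t \<in> {0..T} \<Longrightarrow> linear (A t x)"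
  using field_has_derivative has_derivative_linear by blast

lemma derivative_norm_le: "t \<in> {0..T} \<Longrightarrow> norm (A t x h) \<le> L * norm h"
  by (rule has_derivative_norm_le_lipschitz[OF field_has_derivative lipschitz])

lemma derivative_expand: "t \<in> {0..T} \<Longrightarrow> A t x h = (\<Sum>i\<in>Basis. (h \<bullet> i) *\<^sub>R A t x i)"
  using linear_sum[OF linear_derivative[of t x], of "\<lambda>i. (h \<bullet> i) *\<^sub>R i" Basis]
    linear_cmul[OF linear_derivative[of t x]]
  by (simp add: euclidean_representation)

lemma derivative_uniformly_continuous:
  assumes "e > 0"
  obtains d where "d > 0"
    "\<And>t (x::'a) y h. t \<in> {0..T} \<Longrightarrow> x \<in> cball 0 R \<Longrightarrow> y \<in> cball 0 R \<Longrightarrow> norm (y - x) < d \<Longrightarrow>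
       norm (A t y h - A t x h) \<le> e * norm h"
proof -
  \<comment> \<open>Expanding h in the basis produces \<open>DIM('a)\<close> terms, each at most
    \<open>norm h * \<epsilon>\<close>.\<close>
  define \<epsilon> where "\<epsilon> = e / DIM('a)"
  have "\<epsilon> > 0" using assms by (simp add: \<epsilon>_def)
  have "\<exists>d>0. \<forall>t\<in>{0..T}. \<forall>x\<in>cball 0 R. \<forall>y\<in>cball 0 R. norm (y - x) < d \<longrightarrow>
      norm (A t y i - A t x i) < \<epsilon>" if "i \<in> Basis" for i :: 'a
  proof -
    have "uniformly_continuous_on ({0..T} \<times> cball 0 R) (\<lambda>(t, x). A t x i)"
      using continuous_on_derivative[OF that]
      by (intro compact_uniformly_continuous compact_Times) (auto intro: continuous_on_subset)
    then obtain d where "d > 0" and d: "\<And>p q. p \<in> {0..T} \<times> cball 0 R \<Longrightarrow> q \<in> {0..T} \<times> cball 0 R \<Longrightarrow>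
        dist q p < d \<Longrightarrow> dist ((\<lambda>(t, x). A t x i) q) ((\<lambda>(t, x). A t x i) p) < \<epsilon>"
      unfolding uniformly_continuous_on_def using \<open>\<epsilon> > 0\<close> by meson
    have "norm (A t y i - A t x i) < \<epsilon>"
      if "t \<in> {0..T}" "x \<in> cball 0 R" "y \<in> cball 0 R" "norm (y - x) < d" for t and x y :: 'a
      using d[of "(t, x)" "(t, y)"] that by (simp add: dist_Pair_Pair dist_norm)
    then show ?thesis using \<open>d > 0\<close> by blast
  qed
  then obtain d where d: "\<And>i::'a. i \<in> Basis \<Longrightarrow> d i > 0"
    "\<And>(i::'a) t x y. i \<in> Basis \<Longrightarrow> t \<in> {0..T} \<Longrightarrow> x \<in> cball 0 R \<Longrightarrow> y \<in> cball 0 R \<Longrightarrow>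
       norm (y - x) < d i \<Longrightarrow> norm (A t y i - A t x i) < \<epsilon>"
    by metis
  show ?thesis
  proof (rule that[of "Min (d ` Basis)"])
    show "Min (d ` Basis) > 0" using d(1) by simp
    fix t and x y h :: 'a
    assume h: "t \<in> {0..T}" "x \<in> cball 0 R" "y \<in> cball 0 R" "norm (y - x) < Min (d ` Basis)"
    have "A t y h - A t x h = (\<Sum>i\<in>Basis. (h \<bullet> i) *\<^sub>R (A t y i - A t x i))"
      using h(1) by (simp add: derivative_expand[of t _ h] scaleR_diff_right sum_subtractf)
    also have "norm \<dots> \<le> (\<Sum>i\<in>(Basis::'a set). norm h * \<epsilon>)"
    proof (rule sum_norm_le)
      fix i :: 'a assume i: "i \<in> Basis"
      then have "norm (A t y i - A t x i) \<le> \<epsilon>"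
        using h by (intro less_imp_le d(2)) auto
      then show "norm ((h \<bullet> i) *\<^sub>R (A t y i - A t x i)) \<le> norm h * \<epsilon>"
        using i by (auto intro!: mult_mono Basis_le_norm)
    qed
    also have "\<dots> = e * norm h" by (simp add: \<epsilon>_def)
    finally show "norm (A t y h - A t x h) \<le> e * norm h" .
  qed
qed

text \<open>Compactness of one trajectory and Lipschitz dependence on the start confine all
  neighbouring trajectories to one ball, the compact set on which
  \<open>derivative_uniformly_continuous\<close> is applied.\<close>

lemma flow_bounded:
  obtains R where "\<And>t y. t \<in> {0..T} \<Longrightarrow> norm (y - x) \<le> 1 \<Longrightarrow> ode_flow T v t y \<in> cball 0 R"
proof -
  have "bounded ((\<lambda>t. ode_flow T v t x) ` {0..T})"
    by (intro compact_imp_bounded compact_continuous_image continuous_on_flow) auto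
  then obtain B where B: "\<And>t. t \<in> {0..T} \<Longrightarrow> norm (ode_flow T v t x) \<le> B"
    unfolding bounded_iff by (metis imageI)
  show ?thesis
  proof (rule that[of "B + exp (L * T)"])
    fix t y assume t: "t \<in> {0..T}" and y: "norm (y - x) \<le> 1"
    have "norm (ode_flow T v t y - ode_flow T v t x) \<le> norm (y - x) * exp (L * T)"
      using flow_dist_le[OF t] .
    also have "\<dots> \<le> 1 * exp (L * T)" using y by (intro mult_right_mono) auto
    finally show "ode_flow T v t y \<in> cball 0 (B + exp (L * T))"
      using B[OF t] norm_triangle_ineq2[of "ode_flow T v t y" "ode_flow T v t x"] by simp
  qed
qed

section \<open>The variational equation\<close>

abbreviation flow_derivative :: "real \<Rightarrow> 'a \<Rightarrow> 'a \<Rightarrow> 'a" where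
  "flow_derivative t x h \<equiv> ode_flow T (\<lambda>s. A s (ode_flow T v s x)) t h"

text \<open>Since \<open>norm (A t x h) \<le> L * norm h\<close>, the linearised equation along a
  trajectory is globally Lipschitz in h, and all results of \<open>lipschitz_field\<close> apply to
  it. Joint continuity is obtained from the basis expansion.\<close>

lemma variational_field: "lipschitz_field T L (\<lambda>t. A t (ode_flow T v t x))"
proof
  have "continuous_on ({0..T} \<times> (UNIV::'a set))
      (\<lambda>p. \<Sum>i\<in>Basis. (snd p \<bullet> i) *\<^sub>R A (fst p) (ode_flow T v (fst p) x) i)"
  proof (intro continuous_intros)
    fix i :: 'a assume "i \<in> Basis"
    show "continuous_on ({0..T} \<times> (UNIV::'a set)) (\<lambda>p. A (fst p) (ode_flow T v (fst p) x) i)"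
    proof -
      have "continuous_on ({0..T} \<times> (UNIV::'a set)) (\<lambda>p. ode_flow T v (fst p) x)"
        using continuous_on_compose2[OF continuous_on_flow[of x] continuous_on_fst[OF continuous_on_id],
            of "{0..T} \<times> UNIV"] by auto
      then have "continuous_on ({0..T} \<times> (UNIV::'a set)) (\<lambda>p. (fst p, ode_flow T v (fst p) x))"
        by (intro continuous_on_Pair continuous_on_fst continuous_on_id)
      from continuous_on_compose2[OF continuous_on_derivative[OF \<open>i \<in> Basis\<close>] this]
      show ?thesis by (simp add: image_subset_iff)
    qed
  qed
  then show "continuous_on ({0..T} \<times> UNIV) (\<lambda>(t, h). A t (ode_flow T v t x) h)"
    by (rule continuous_on_eq) (auto simp flip: derivative_expand)
  show "norm (A t (ode_flow T v t x) h - A t (ode_flow T v t x) k) \<le> L * norm (h - k)"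
    if "t \<in> {0..T}" for t h k
    using derivative_norm_le[OF that] linear_diff[OF linear_derivative[OF that]] by metis
qed (use T_nonneg L_nonneg in auto)

lemmas variational_solution = lipschitz_field.flow_solution[OF variational_field]

lemma flow_derivative_vector_derivative:
  "t \<in> {0..T} \<Longrightarrow> ((\<lambda>s. flow_derivative s x h) has_vector_derivative
     A t (ode_flow T v t x) (flow_derivative t x h)) (at t within {0..T})"
  using variational_solution[of x h] unfolding ode_solution_def by blast

lemma continuous_on_variation:
  "continuous_on {0..T} (\<lambda>t. A t (ode_flow T v t x) (flow_derivative t y h))"
  using lipschitz_field.continuous_on_field_compose[OF variational_field continuous_on_id,
      where \<xi> = "\<lambda>t. flow_derivative t y h"]
    lipschitz_field.continuous_on_flow[OF variational_field] by auto

text \<open>Superposition: sums and multiples of variational solutions are again solutions, and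
  uniqueness identifies them by their initial values.\<close>

lemma linear_flow_derivative:
  assumes t: "t \<in> {0..T}"
  shows "linear (flow_derivative t x)"
proof -
  interpret var: lipschitz_field T L "\<lambda>t. A t (ode_flow T v t x)" by (rule variational_field)
  have sol: "((\<lambda>s. flow_derivative s x h) has_vector_derivative
     A t (ode_flow T v t x) (flow_derivative t x h)) (at t within {0..T})" if "t \<in> {0..T}" for t h
    using flow_derivative_vector_derivative[OF that] .
  show ?thesis
  proof (rule linearI)
    fix h k
    have "ode_solution T (\<lambda>t. A t (ode_flow T v t x)) (\<lambda>t. flow_derivative t x h + flow_derivative t x k)"
      unfolding ode_solution_def
      by (auto intro!: derivative_eq_intros sol simp: linear_add[OF linear_derivative])
    from var.flow_unique[OF this t]
    show "flow_derivative t x (h + k) = flow_derivative t x h + flow_derivative t x k"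
      by simp
  next
    fix c h
    have "ode_solution T (\<lambda>t. A t (ode_flow T v t x)) (\<lambda>t. c *\<^sub>R flow_derivative t x h)"
      unfolding ode_solution_def
      by (auto intro!: derivative_eq_intros sol simp: linear_cmul[OF linear_derivative])
    from var.flow_unique[OF this t]
    show "flow_derivative t x (c *\<^sub>R h) = c *\<^sub>R flow_derivative t x h"
      by simp
  qed
qed

lemma flow_derivative_norm_le:
  assumes "t \<in> {0..T}"
  shows "norm (flow_derivative t x h) \<le> norm h * exp (L * T)"
  using lipschitz_field.flow_dist_le[OF variational_field assms, of x h 0]
    linear_0[OF linear_flow_derivative[OF assms]] by simp

text \<open>For neighbouring trajectories X and Y and k = y - x, the error Z = Y - X - DX k starts
  at 0 and satisfies Z' = A(X) Z + r, where r is the linearisation remainder of the field. Uniform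
  continuity of A makes r small compared with k uniformly in time, and Gronwall transfers this to
  Z.\<close>

theorem flow_has_derivative:
  assumes t: "t \<in> {0..T}"
  shows "(ode_flow T v t has_derivative flow_derivative t x) (at x)"
  unfolding has_derivative_at_alt
proof (intro conjI allI impI)
  show "bounded_linear (flow_derivative t x)"
    using linear_flow_derivative[OF t] by (simp add: linear_conv_bounded_linear)
  fix e :: real assume "e > 0"
  define M where "M = exp (L * T)"
  \<comment> \<open>Gronwall will yield the factor \<open>\<epsilon> * M * T * M\<close>; writing T
    + 1 keeps the denominator positive for T = 0.\<close>
  define \<epsilon> where "\<epsilon> = e / (M * M * (T + 1))"
  have M: "M > 0" by (simp add: M_def)
  have "\<epsilon> > 0" using \<open>e > 0\<close> T_nonneg M by (simp add: \<epsilon>_def)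
  have \<epsilon>_le: "\<epsilon> * M * T * M \<le> e"
    using \<open>e > 0\<close> T_nonneg M by (simp add: \<epsilon>_def divide_le_eq)
  obtain R where R: "\<And>s y. s \<in> {0..T} \<Longrightarrow> norm (y - x) \<le> 1 \<Longrightarrow> ode_flow T v s y \<in> cball 0 R"
    using flow_bounded[of x] by metis
  obtain d where "d > 0" and d: "\<And>s p q h. s \<in> {0..T} \<Longrightarrow> p \<in> cball 0 R \<Longrightarrow> q \<in> cball 0 R \<Longrightarrow>
      norm (q - p) < d \<Longrightarrow> norm (A s q h - A s p h) \<le> \<epsilon> * norm h"
    using derivative_uniformly_continuous[OF \<open>\<epsilon> > 0\<close>] by metis
  \<comment> \<open>The radius 1 is the reach of \<open>flow_bounded\<close>; \<open>d / M\<close>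
    keeps the two trajectories within d of each other, since the flow is Lipschitz with constant
    M.\<close>
  show "\<exists>d>0. \<forall>y. norm (y - x) < d \<longrightarrow>
      norm (ode_flow T v t y - ode_flow T v t x - flow_derivative t x (y - x)) \<le> e * norm (y - x)"
  proof (intro exI[of _ "min 1 (d / M)"] conjI allI impI)
    show "min 1 (d / M) > 0" using \<open>d > 0\<close> M by simp
    fix y assume y: "norm (y - x) < min 1 (d / M)"
    define k where "k = y - x"
    have kM: "norm k * M < d" using y M by (simp add: k_def field_simps)
    let ?X = "\<lambda>s. ode_flow T v s x" and ?Y = "\<lambda>s. ode_flow T v s y"
    let ?Z = "\<lambda>s. ?Y s - ?X s - flow_derivative s x k"
    have dist: "norm (?Y s - ?X s) \<le> norm k * M" if "s \<in> {0..T}" for s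
      using flow_dist_le[OF that] by (simp add: k_def M_def)
    have lin: "norm (v s (?Y s) - v s (?X s) - A s (?X s) (?Y s - ?X s)) \<le> \<epsilon> * M * norm k"
      if s: "s \<in> {0..T}" for s
    proof -
      have mem: "?X s \<in> cball 0 R" "?Y s \<in> cball 0 R"
        using R[OF s, of x] R[OF s, of y] y by auto
      \<comment> \<open>The mean value inequality needs the segment between the two points inside
        the region where A varies by at most \<epsilon>; an intersection of two balls is
        convex.\<close>
      have "norm (v s (?Y s) - v s (?X s) - A s (?X s) (?Y s - ?X s)) \<le> norm (?Y s - ?X s) * \<epsilon>"
      proof (rule differentiable_bound_linearization[where S = "cball 0 R \<inter> ball (?X s) d"
            and f = "v s" and f' = "A s" and ?x0.0 = "?X s" and a = "?X s" and b = "?Y s"])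
        have S: "?X s \<in> cball 0 R \<inter> ball (?X s) d" "?Y s \<in> cball 0 R \<inter> ball (?X s) d"
          using mem dist[OF s] kM \<open>d > 0\<close> by (auto simp: dist_norm norm_minus_commute)
        then show "?X s \<in> cball 0 R \<inter> ball (?X s) d" by blast
        show "?X s + r *\<^sub>R (?Y s - ?X s) \<in> cball 0 R \<inter> ball (?X s) d" if "r \<in> {0..1}" for r
        proof -
          have "?X s + r *\<^sub>R (?Y s - ?X s) = (1 - r) *\<^sub>R ?X s + r *\<^sub>R ?Y s"
            by (simp add: algebra_simps)
          moreover have "convex (cball 0 R \<inter> ball (?X s) d)"
            by (intro convex_Int convex_cball convex_ball)
          ultimately show ?thesis using convexD_alt[OF _ S, of r] that by auto
        qed
        fix z assume z: "z \<in> cball 0 R \<inter> ball (?X s) d"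
        show "(v s has_derivative A s z) (at z within cball 0 R \<inter> ball (?X s) d)"
          using field_has_derivative[OF s] by (rule has_derivative_at_withinI)
        from z show "onorm (A s z - A s (?X s)) \<le> \<epsilon>"
          using d[OF s mem(1), of z] \<open>\<epsilon> > 0\<close>
          by (intro onorm_le) (auto simp: dist_norm norm_minus_commute)
      qed
      also have "\<dots> \<le> norm k * M * \<epsilon>"
        using dist[OF s] \<open>\<epsilon> > 0\<close> by (intro mult_right_mono) auto
      finally show ?thesis by (simp add: mult_ac)
    qed
    have "norm (?Z t) \<le> (norm (?Z 0) + \<epsilon> * M * norm k * T) * exp (L * T)"
    proof (rule gronwall_norm[OF _ _ _ L_nonneg _ t])
      fix s assume s: "s \<in> {0..T}"
      show "(?Z has_vector_derivative v s (?Y s) - v s (?X s) - A s (?X s) (flow_derivative s x k))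
          (at s within {0..T})"
        using flow_solution[of y] flow_solution[of x] s flow_derivative_vector_derivative[OF s]
        unfolding ode_solution_def by (intro derivative_intros) auto
      \<comment> \<open>Inserting \<open>A s (?X s) (?Y s - ?X s)\<close> separates the part linear
        in the error from the remainder.\<close>
      have split: "v s (?Y s) - v s (?X s) - A s (?X s) (flow_derivative s x k) =
          A s (?X s) (?Z s) + (v s (?Y s) - v s (?X s) - A s (?X s) (?Y s - ?X s))"
        by (simp add: linear_diff[OF linear_derivative[OF s]])
      show "norm (v s (?Y s) - v s (?X s) - A s (?X s) (flow_derivative s x k))
          \<le> L * norm (?Z s) + \<epsilon> * M * norm k"
        unfolding split by (intro norm_triangle_mono derivative_norm_le[OF s] lin[OF s])
    next
      show "continuous_on {0..T}
          (\<lambda>s. v s (?Y s) - v s (?X s) - A s (?X s) (flow_derivative s x k))"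
        by (intro continuous_on_diff continuous_on_variation continuous_on_field_compose
            continuous_on_flow continuous_on_id) auto
    qed (use \<open>\<epsilon> > 0\<close> M in auto)
    also have "\<dots> = (\<epsilon> * M * T * M) * norm k"
      using lipschitz_field.flow_0[OF variational_field, of x] by (simp add: k_def M_def mult_ac)
    also have "\<dots> \<le> e * norm k" by (intro mult_right_mono \<epsilon>_le) auto
    finally show "norm (ode_flow T v t y - ode_flow T v t x - flow_derivative t x (y - x))
        \<le> e * norm (y - x)" by (simp add: k_def)
  qed
qed

text \<open>The difference Z of the variational solutions along Y and X starts at 0 and satisfies Z'
  = A(Y) Z + (A(Y) - A(X)) DX h. The inhomogeneity is small for close starting points, so Gronwall
  applies again.\<close>

lemma continuous_on_flow_derivative:
  assumes t: "t \<in> {0..T}"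
  shows "continuous_on UNIV (\<lambda>x. flow_derivative t x h)"
  unfolding continuous_on_iff
proof (intro ballI allI impI)
  fix x :: 'a and e :: real assume "e > 0"
  define M where "M = exp (L * T)"
  \<comment> \<open>The summands 1 keep the denominator positive for T = 0 or h = 0 and make the
    final inequality strict.\<close>
  define \<epsilon> where "\<epsilon> = e / (M * M * (T + 1) * (norm h + 1))"
  have M: "M > 0" by (simp add: M_def)
  have h1: "norm h + 1 > 0" by (intro add_nonneg_pos) auto
  have "\<epsilon> > 0" using \<open>e > 0\<close> T_nonneg M h1 by (simp add: \<epsilon>_def)
  obtain R where R: "\<And>s y. s \<in> {0..T} \<Longrightarrow> norm (y - x) \<le> 1 \<Longrightarrow> ode_flow T v s y \<in> cball 0 R"
    using flow_bounded[of x] by metis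
  obtain d where "d > 0" and d: "\<And>s p q h. s \<in> {0..T} \<Longrightarrow> p \<in> cball 0 R \<Longrightarrow> q \<in> cball 0 R \<Longrightarrow>
      norm (q - p) < d \<Longrightarrow> norm (A s q h - A s p h) \<le> \<epsilon> * norm h"
    using derivative_uniformly_continuous[OF \<open>\<epsilon> > 0\<close>] by metis
  show "\<exists>d>0. \<forall>y\<in>UNIV. dist y x < d \<longrightarrow> dist (flow_derivative t y h) (flow_derivative t x h) < e"
  proof (intro exI[of _ "min 1 (d / M)"] conjI ballI impI)
    show "min 1 (d / M) > 0" using \<open>d > 0\<close> M by simp
    fix y assume y: "dist y x < min 1 (d / M)"
    have yM: "norm (y - x) * M < d" using y M by (simp add: dist_norm field_simps)
    let ?X = "\<lambda>s. ode_flow T v s x" and ?Y = "\<lambda>s. ode_flow T v s y"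
    let ?Z = "\<lambda>s. flow_derivative s y h - flow_derivative s x h"
    have "norm (?Z t) \<le> (norm (?Z 0) + \<epsilon> * (norm h * M) * T) * exp (L * T)"
    proof (rule gronwall_norm[OF _ _ _ L_nonneg _ t])
      fix s assume s: "s \<in> {0..T}"
      show "(?Z has_vector_derivative
          A s (?Y s) (flow_derivative s y h) - A s (?X s) (flow_derivative s x h)) (at s within {0..T})"
        by (intro derivative_intros flow_derivative_vector_derivative s)
      have "norm (?Y s - ?X s) < d"
        using flow_dist_le[OF s, of y x] yM by (simp add: M_def)
      then have "norm (A s (?Y s) (flow_derivative s x h) - A s (?X s) (flow_derivative s x h))
          \<le> \<epsilon> * norm (flow_derivative s x h)"
        using R[OF s, of x] R[OF s, of y] y by (intro d[OF s]) (auto simp: dist_norm)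
      also have "\<dots> \<le> \<epsilon> * (norm h * M)"
        using flow_derivative_norm_le[OF s] \<open>\<epsilon> > 0\<close> by (intro mult_left_mono) (auto simp: M_def)
      finally have "norm (A s (?Y s) (flow_derivative s x h) - A s (?X s) (flow_derivative s x h))
          \<le> \<epsilon> * (norm h * M)" .
      then have "norm (A s (?Y s) (?Z s) +
          (A s (?Y s) (flow_derivative s x h) - A s (?X s) (flow_derivative s x h)))
          \<le> L * norm (?Z s) + \<epsilon> * (norm h * M)"
        by (intro norm_triangle_mono derivative_norm_le[OF s])
      then show "norm (A s (?Y s) (flow_derivative s y h) - A s (?X s) (flow_derivative s x h))
          \<le> L * norm (?Z s) + \<epsilon> * (norm h * M)"
        by (simp add: linear_diff[OF linear_derivative[OF s]])
    qed (use \<open>\<epsilon> > 0\<close> M in \<open>auto intro!: continuous_on_diff continuous_on_variation\<close>)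
    also have "\<dots> = \<epsilon> * (M * M) * (norm h * T)"
      using lipschitz_field.flow_0[OF variational_field] by (simp add: M_def mult_ac)
    also have "\<dots> < \<epsilon> * (M * M) * ((norm h + 1) * (T + 1))"
    proof (intro mult_strict_left_mono)
      have "0 < norm h + T + 1" using T_nonneg h1 by linarith
      then show "norm h * T < (norm h + 1) * (T + 1)" by (simp add: algebra_simps)
    qed (use \<open>\<epsilon> > 0\<close> M in simp)
    also have "\<dots> = e" using M T_nonneg h1 by (simp add: \<epsilon>_def)
    finally show "dist (flow_derivative t y h) (flow_derivative t x h) < e"
      by (simp add: dist_norm)
  qed
qed

lemma C_space_flow:
  assumes t: "t \<in> {0..T}"
  shows "C_space 1 (ode_flow T v t)"
proof -
  have "partial_deriv i (ode_flow T v t) = (\<lambda>x. flow_derivative t x i)" for i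
    unfolding partial_deriv_def
    using frechet_derivative_at[OF flow_has_derivative[OF t]] by metis
  moreover have "ode_flow T v t differentiable_on UNIV"
    using flow_has_derivative[OF t] by (auto simp: differentiable_on_def differentiable_def)
  ultimately show ?thesis
    using continuous_on_flow_derivative[OF t] by simp
qed

section \<open>The flow maps as diffeomorphisms\<close>

lemma reverse_C1_field:
  assumes S: "S \<in> {0..T}"
  shows "C1_field S L (\<lambda>t x. - v (S - t) x) (\<lambda>t x h. - A (S - t) x h)"
proof (intro C1_field.intro C1_field_axioms.intro reverse_field[OF S])
  show "((\<lambda>x. - v (S - t) x) has_derivative (\<lambda>h. - A (S - t) x h)) (at x)" if "t \<in> {0..S}" for t x
    using that S by (intro has_derivative_minus field_has_derivative) auto
  fix h :: 'a assume "h \<in> Basis"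
  have "continuous_on ({0..S} \<times> UNIV) (\<lambda>p. A (S - fst p) (snd p) h)"
    using continuous_on_compose2[OF continuous_on_derivative[OF \<open>h \<in> Basis\<close>],
        of "{0..S} \<times> UNIV" "\<lambda>p. (S - fst p, snd p)"] S
    by (force intro!: continuous_intros)
  then show "continuous_on ({0..S} \<times> UNIV) (\<lambda>(t, x). - A (S - t) x h)"
    by (auto simp: case_prod_unfold intro: continuous_intros)
qed

theorem flow_C1_diffeomorphism:
  assumes S: "S \<in> {0..T}"
  shows "C1_diffeomorphism (ode_flow T v S)"
proof -
  interpret rev: C1_field S L "\<lambda>t x. - v (S - t) x" "\<lambda>t x h. - A (S - t) x h"
    by (rule reverse_C1_field[OF S])
  have "bij (ode_flow T v S)"
    using reverse_flow[OF S] flow_reverse[OF S]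
    by (intro o_bij[of "ode_flow S (\<lambda>t x. - v (S - t) x) S"]) (auto simp: fun_eq_iff)
  moreover have "inv (ode_flow T v S) = ode_flow S (\<lambda>t x. - v (S - t) x) S"
    using reverse_flow[OF S] flow_reverse[OF S] by (intro inv_equality) auto
  moreover have "S \<in> {0..S}" using S by simp
  ultimately show ?thesis
    unfolding C1_diffeomorphism_def using C_space_flow[OF S] rev.C_space_flow by metis
qed

end

section \<open>Determinants and change of variables\<close>

text \<open>Jacobi's formula for M' = B M. The Leibniz expansion differentiates one row at a time.
  Row k of B M is a combination of the rows of M, and all but its multiple of row k produce two
  equal rows, so only the diagonal entries of B survive.\<close>

lemma det_has_real_derivative:
  fixes M :: "real \<Rightarrow> real^'n^'n"
  assumes der: "\<And>i j. ((\<lambda>t. M t $ i $ j) has_real_derivative (B ** M t0) $ i $ j) (at t0)"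
  shows "((\<lambda>t. det (M t)) has_real_derivative trace B * det (M t0)) (at t0)"
proof -
  define P where "P = {p. p permutes (UNIV :: 'n set)}"
  define R where "R k = (\<chi> i. if i = k then (B ** M t0) $ k else M t0 $ i)" for k
  have "((\<lambda>t. det (M t)) has_real_derivative
      (\<Sum>p\<in>P. of_int (sign p) * (\<Sum>k\<in>UNIV. (B ** M t0) $ k $ p k * (\<Prod>i\<in>UNIV - {k}. M t0 $ i $ p i))))
      (at t0)"
    unfolding det_def P_def by (intro derivative_intros DERIV_cmult has_field_derivative_prod der)
  also have "(\<Sum>p\<in>P. of_int (sign p) * (\<Sum>k\<in>UNIV. (B ** M t0) $ k $ p k * (\<Prod>i\<in>UNIV - {k}. M t0 $ i $ p i)))
      = (\<Sum>p\<in>P. \<Sum>k\<in>UNIV. of_int (sign p) * (\<Prod>i\<in>UNIV. R k $ i $ p i))"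
  proof -
    have "(\<Prod>i\<in>UNIV. R k $ i $ p i) = (B ** M t0) $ k $ p k * (\<Prod>i\<in>UNIV - {k}. M t0 $ i $ p i)" for k p
      by (subst prod.remove[of UNIV k]) (auto simp: R_def intro!: prod.cong)
    then show ?thesis by (simp add: sum_distrib_left)
  qed
  also have "\<dots> = (\<Sum>k\<in>UNIV. det (R k))"
    unfolding det_def P_def by (rule sum.swap)
  also have "\<dots> = (\<Sum>k\<in>UNIV. B $ k $ k * det (M t0))"
  proof (rule sum.cong[OF refl])
    fix k
    have row: "(B ** M t0) $ k = (\<Sum>j\<in>UNIV. B $ k $ j *s M t0 $ j)"
      by (simp add: matrix_matrix_mult_def vec_eq_iff)
    have "det (R k) = (\<Sum>j\<in>UNIV. B $ k $ j * det (\<chi> i. if i = k then M t0 $ j else M t0 $ i))"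
      unfolding R_def row by (simp add: det_linear_row_sum det_row_mul)
    also have "\<dots> = (\<Sum>j\<in>UNIV. if j = k then B $ k $ k * det (M t0) else 0)"
    proof (rule sum.cong[OF refl])
      fix j
      show "B $ k $ j * det (\<chi> i. if i = k then M t0 $ j else M t0 $ i) =
          (if j = k then B $ k $ k * det (M t0) else 0)"
      proof (cases "j = k")
        case True
        then have "(\<chi> i. if i = k then M t0 $ j else M t0 $ i) = M t0" by (simp add: vec_eq_iff)
        then show ?thesis using True by simp
      next
        case False
        have "det (\<chi> i. if i = k then M t0 $ j else M t0 $ i) = 0"
          by (rule det_identical_rows[OF False]) (simp add: row_def False)
        then show ?thesis using False by simp
      qed
    qed
    finally show "det (R k) = B $ k $ k * det (M t0)" by simp
  qed
  also have "\<dots> = trace B * det (M t0)" by (simp add: trace_def sum_distrib_right)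
  finally show ?thesis .
qed

text \<open>The change of variables theorem of the library is restricted to well-ordered index types.
  Every finite type has a well-ordered copy.\<close>

typedef 'n ranked = "UNIV :: 'n set" morphisms unrank rank ..

lemma rank_unrank [simp]: "rank (unrank i) = i" "unrank (rank k) = k"
  by (simp_all add: unrank_inverse rank_inverse)

declare unrank_inject [simp]

lemma bij_unrank: "bij unrank"
  by (rule o_bij[of rank]) (auto simp: fun_eq_iff)

lemma bij_rank: "bij rank"
  by (rule o_bij[of unrank]) (auto simp: fun_eq_iff)

instance ranked :: (finite) finite
proof
  show "finite (UNIV :: 'a ranked set)"
    unfolding bij_is_surj[OF bij_rank, symmetric] by (intro finite_imageI finite)
qed

instantiation ranked :: (finite) wellorder
begin

definition less_eq_ranked :: "'a ranked \<Rightarrow> 'a ranked \<Rightarrow> bool" where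
  "less_eq_ranked i j \<longleftrightarrow> to_nat (unrank i) \<le> to_nat (unrank j)"

definition less_ranked :: "'a ranked \<Rightarrow> 'a ranked \<Rightarrow> bool" where
  "less_ranked i j \<longleftrightarrow> to_nat (unrank i) < to_nat (unrank j)"

instance
proof
  fix P :: "'a ranked \<Rightarrow> bool" and i
  assume step: "\<And>i. (\<And>j. j < i \<Longrightarrow> P j) \<Longrightarrow> P i"
  show "P i"
  proof (induction i rule: measure_induct_rule[of "\<lambda>i. to_nat (unrank i)"])
    case (less i)
    show ?case by (rule step) (rule less, simp add: less_ranked_def)
  qed
qed (auto simp: less_eq_ranked_def less_ranked_def)

end

section \<open>Relabelling of coordinates\<close>

definition rank_vec :: "'a^'n \<Rightarrow> 'a^'n ranked" where
  "rank_vec x = (\<chi> i. x $ unrank i)"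

definition unrank_vec :: "'a^'n ranked \<Rightarrow> 'a^'n" where
  "unrank_vec y = (\<chi> i. y $ rank i)"

lemma rank_vec_nth [simp]: "rank_vec x $ i = x $ unrank i"
  and unrank_vec_nth [simp]: "unrank_vec y $ k = y $ rank k"
  by (simp_all add: rank_vec_def unrank_vec_def)

lemma rank_vec_inverse [simp]: "unrank_vec (rank_vec x) = x" "rank_vec (unrank_vec y) = y"
  by (simp_all add: vec_eq_iff)

lemma unrank_vec_axis [simp]: "unrank_vec (axis j c) = axis (unrank j) c"
  by (auto simp: vec_eq_iff axis_def)

lemma bounded_linear_rank_vec: "bounded_linear (rank_vec :: real^'n \<Rightarrow> real^'n ranked)"
  and bounded_linear_unrank_vec: "bounded_linear (unrank_vec :: real^'n ranked \<Rightarrow> real^'n)"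
  by (auto simp: vec_eq_iff intro!: linearI simp flip: linear_conv_bounded_linear)

lemma borel_measurable_rank_vec [measurable]: "(rank_vec :: real^'n \<Rightarrow> real^'n ranked) \<in> borel_measurable borel"
  and borel_measurable_unrank_vec [measurable]: "(unrank_vec :: real^'n ranked \<Rightarrow> real^'n) \<in> borel_measurable borel"
  by (auto intro!: borel_measurable_continuous_onI linear_continuous_on
      bounded_linear_rank_vec bounded_linear_unrank_vec)

lemma prod_Basis_vec:
  fixes x :: "real^'n"
  shows "(\<Prod>b\<in>Basis. x \<bullet> b) = (\<Prod>i\<in>UNIV. x $ i)"
proof -
  have "(Basis :: (real^'n) set) = (\<lambda>i. axis i 1) ` UNIV"
    by (auto simp: Basis_vec_def)
  moreover have "inj (\<lambda>i::'n. axis i (1::real))"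
    by (auto simp: inj_def axis_eq_axis)
  ultimately show ?thesis by (subst prod.reindex_cong) (auto simp: inner_axis)
qed

text \<open>Relabelling maps boxes to boxes with the same side lengths, and Lebesgue measure is
  determined by its values on boxes.\<close>

lemma lborel_distr_rank_vec: "distr lborel borel (rank_vec :: real^'n \<Rightarrow> real^'n ranked) = lborel"
proof (rule lborel_eqI[symmetric])
  fix l u :: "real^'n ranked"
  assume le: "\<And>b. b \<in> Basis \<Longrightarrow> l \<bullet> b \<le> u \<bullet> b"
  have le': "l $ i \<le> u $ i" for i
    using le[of "axis i 1"] by (simp add: inner_axis axis_in_Basis_iff)
  have "(rank_vec :: real^'n \<Rightarrow> real^'n ranked) -` box l u = box (unrank_vec l) (unrank_vec u)"
    by (auto simp: mem_box_cart) (metis rank_unrank)+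
  then have "emeasure (distr lborel borel (rank_vec :: real^'n \<Rightarrow> real^'n ranked)) (box l u) =
      emeasure lborel (box (unrank_vec l) (unrank_vec u))"
    by (subst emeasure_distr) auto
  also have "\<dots> = (\<Prod>b\<in>Basis. (unrank_vec u - unrank_vec l) \<bullet> b)"
    using le' by (intro emeasure_lborel_box) (auto simp: Basis_vec_def inner_axis)
  also have "(\<Prod>b\<in>Basis. (unrank_vec u - unrank_vec l) \<bullet> b) = (\<Prod>k\<in>UNIV. (u - l) $ rank k)"
    by (simp add: prod_Basis_vec)
  also have "\<dots> = (\<Prod>i\<in>UNIV. (u - l) $ i)"
    using bij_rank by (rule prod.reindex_bij_betw)
  also have "\<dots> = (\<Prod>b\<in>Basis. (u - l) \<bullet> b)"
    by (simp add: prod_Basis_vec)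
  finally show "emeasure (distr lborel borel (rank_vec :: real^'n \<Rightarrow> real^'n ranked)) (box l u) =
      (\<Prod>b\<in>Basis. (u - l) \<bullet> b)" .
qed simp

text \<open>For a Borel set A the mass of the preimage of A under g is rewritten by the change of
  variables theorem. That theorem speaks of \<open>has_integral\<close>; nonnegativity of the
  densities converts its value into both measures.\<close>

lemma distr_density_wellorder:
  fixes g h :: "real^'n::{finite,wellorder} \<Rightarrow> real^'n::_" and r0 r1 :: "real^'n::_ \<Rightarrow> real"
  assumes der_g: "\<And>x. (g has_derivative g' x) (at x)" and der_h: "\<And>y. (h has_derivative h' y) (at y)"
    and hg: "\<And>x. h (g x) = x" and gh: "\<And>y. g (h y) = y"
    and r1: "integrable lborel r1" "\<And>x. r1 x \<ge> 0" and r0: "r0 \<in> borel_measurable borel"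
    and det: "\<And>x. r0 x = \<bar>det (matrix (g' x))\<bar> * r1 (g x)"
  shows "distr (density lborel r0) borel g = density lborel r1"
proof (rule measure_eqI)
  have "continuous_on UNIV g"
    using der_g by (auto intro: has_derivative_continuous_on)
  then have g_meas [measurable]: "g \<in> borel_measurable borel"
    by (rule borel_measurable_continuous_onI)
  have r1_meas [measurable]: "r1 \<in> borel_measurable borel"
    using r1(1) by auto
  note r0 [measurable]
  fix A assume "A \<in> sets (distr (density lborel (\<lambda>x. ennreal (r0 x))) borel g)"
  then have A [measurable]: "A \<in> sets borel" by simp
  have "set_integrable lborel A r1"
    using r1(1) unfolding set_integrable_def by (intro integrable_mult_indicator) auto
  then obtain b where b: "(r1 has_integral b) A"
    using set_borel_integral_eq_integral(1) by blast
  \<comment> \<open>The change of variables theorem also asks that the derivative of h invert that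
    of g; this is the chain rule for \<open>h \<circ> g = id\<close>.\<close>
  have inverse: "h' y \<circ> g' (h y) = id" for y
  proof -
    have "((h \<circ> g) has_derivative (h' y \<circ> g' (h y))) (at (h y))"
      using der_g[of "h y"] der_h[of "g (h y)"] unfolding gh by (intro diff_chain_at) (auto simp: gh)
    moreover have "h \<circ> g = id" using hg by auto
    ultimately show ?thesis
      using has_derivative_id has_derivative_unique by metis
  qed
  have "((\<lambda>x. \<bar>det (matrix (g' x))\<bar> * r1 (g x)) has_integral b) (g -` A)"
    using b cov_invertible_nonneg_eq[of "g -` A" g g' A h h' r1 b]
      has_derivative_at_withinI[OF der_g] has_derivative_at_withinI[OF der_h] r1(2) hg gh inverse
    by auto
  moreover have "(\<lambda>x. \<bar>det (matrix (g' x))\<bar> * r1 (g x)) = r0" using det by auto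
  ultimately have b': "(r0 has_integral b) (g -` A)" by simp
  have "r0 x \<ge> 0" for x using r1(2) by (simp add: det)
  then have "(\<integral>\<^sup>+x. ennreal (r0 x) * indicator (g -` A) x \<partial>lborel) = ennreal b"
    using nn_integral_has_integral_lebesgue'[OF _ b'] by simp
  moreover have "(\<integral>\<^sup>+x. ennreal (r1 x) * indicator A x \<partial>lborel) = ennreal b"
    using nn_integral_has_integral_lebesgue'[OF _ b] r1(2) by simp
  moreover have "g -` A \<in> sets borel"
    using measurable_sets[OF g_meas A] by simp
  ultimately show "emeasure (distr (density lborel r0) borel g) A = emeasure (density lborel r1) A"
    by (simp add: emeasure_distr emeasure_density)
qed simp

text \<open>Conjugation with the relabelling reduces to well-ordered indices. The Jacobian is stated
  in relabelled coordinates, which avoids proving that determinants are invariant under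
  relabelling.\<close>

theorem distr_density_change_of_variables:
  fixes g h :: "real^'n \<Rightarrow> real^'n" and r0 r1 :: "real^'n \<Rightarrow> real"
  assumes der_g: "\<And>x. (g has_derivative g' x) (at x)" and der_h: "\<And>y. (h has_derivative h' y) (at y)"
    and hg: "\<And>x. h (g x) = x" and gh: "\<And>y. g (h y) = y"
    and r1: "integrable lborel r1" "\<And>x. r1 x \<ge> 0" and r0: "r0 \<in> borel_measurable borel"
    and det: "\<And>x. r0 x = \<bar>det (\<chi> i j :: 'n ranked. g' x (axis (unrank j) 1) $ unrank i)\<bar> * r1 (g x)"
  shows "distr (density lborel r0) borel g = density lborel r1"
proof -
  have "continuous_on UNIV g"
    using der_g by (auto intro: has_derivative_continuous_on)
  then have g_meas [measurable]: "g \<in> borel_measurable borel"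
    by (rule borel_measurable_continuous_onI)
  have r1_meas [measurable]: "r1 \<in> borel_measurable borel"
    using r1(1) by auto
  note r0 [measurable]
  note rank_der = bounded_linear.has_derivative[OF bounded_linear_rank_vec]
    and unrank_der = bounded_linear_imp_has_derivative[OF bounded_linear_unrank_vec]
  \<comment> \<open>As \<open>rank_vec\<close> preserves Lebesgue measure, relabelling a density
    amounts to pushing its measure forward.\<close>
  have dens: "density lborel (\<lambda>y. ennreal (r (unrank_vec y))) = distr (density lborel (\<lambda>x. ennreal (r x))) borel rank_vec"
    if [measurable]: "r \<in> borel_measurable borel" for r :: "real^'n \<Rightarrow> real"
  proof -
    have "density (distr lborel borel rank_vec) (\<lambda>y. ennreal (r (unrank_vec y))) =
        distr (density lborel (\<lambda>x. ennreal (r (unrank_vec (rank_vec x))))) borel rank_vec"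
      by (rule density_distr) auto
    then show ?thesis by (simp add: lborel_distr_rank_vec)
  qed
  let ?g = "\<lambda>y. rank_vec (g (unrank_vec y))" and ?h = "\<lambda>y. rank_vec (h (unrank_vec y))"
  have "distr (density lborel (\<lambda>y. ennreal (r0 (unrank_vec y)))) borel ?g = density lborel (\<lambda>y. ennreal (r1 (unrank_vec y)))"
  proof (rule distr_density_wellorder)
    show "(?g has_derivative (\<lambda>k. rank_vec (g' (unrank_vec y) (unrank_vec k)))) (at y)" for y
      by (intro rank_der has_derivative_compose[OF unrank_der der_g])
    show "(?h has_derivative (\<lambda>k. rank_vec (h' (unrank_vec y) (unrank_vec k)))) (at y)" for y
      by (intro rank_der has_derivative_compose[OF unrank_der der_h])
    have "integrable (distr lborel borel rank_vec) (\<lambda>y. r1 (unrank_vec y))"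
      using r1(1) by (subst integrable_distr_eq) auto
    then show "integrable lborel (\<lambda>y. r1 (unrank_vec y))" by (simp add: lborel_distr_rank_vec)
    show "r0 (unrank_vec y) =
        \<bar>det (matrix (\<lambda>k. rank_vec (g' (unrank_vec y) (unrank_vec k))))\<bar> * r1 (unrank_vec (?g y))" for y
      by (simp add: det matrix_def)
  qed (use hg gh r1(2) in auto)
  then have "distr (distr (distr (density lborel r0) borel rank_vec) borel ?g) borel unrank_vec =
      distr (distr (density lborel r1) borel rank_vec) borel unrank_vec"
    by (simp add: dens)
  then show ?thesis
    by (simp add: distr_distr o_def distr_id2 cong: distr_cong)
qed

section \<open>Liouville's formula and transport of densities\<close>

text \<open>det DX(t; x), in the relabelled coordinates of the change of variables theorem.\<close>

definition flow_jacobian ::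
    "real \<Rightarrow> (real \<Rightarrow> real^'n \<Rightarrow> real^'n) \<Rightarrow> (real \<Rightarrow> real^'n \<Rightarrow> real^'n \<Rightarrow> real^'n) \<Rightarrow> real \<Rightarrow> real^'n \<Rightarrow> real" where
  "flow_jacobian T v A t x =
     det (\<chi> i j :: 'n ranked. ode_flow T (\<lambda>s. A s (ode_flow T v s x)) t (axis (unrank j) 1) $ unrank i)"

lemma continuous_on_det:
  fixes M :: "'a::topological_space \<Rightarrow> real^'n^'n"
  assumes "\<And>i j. continuous_on S (\<lambda>t. M t $ i $ j)"
  shows "continuous_on S (\<lambda>t. det (M t))"
  unfolding det_def by (intro continuous_intros assms)

section \<open>Liouville's formula in Cartesian coordinates\<close>

context
  fixes T L :: real and v :: "real \<Rightarrow> real^'n \<Rightarrow> real^'n" and A :: "real \<Rightarrow> real^'n \<Rightarrow> real^'n \<Rightarrow> real^'n"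
  assumes C1: "C1_field T L v A"
begin

interpretation C1_field T L v A by (rule C1)

lemma flow_jacobian_0 [simp]: "flow_jacobian T v A 0 x = 1"
proof -
  have "(\<chi> i j :: 'n ranked. flow_derivative 0 x (axis (unrank j) 1) $ unrank i) = mat 1"
    by (auto simp: lipschitz_field.flow_0[OF variational_field] vec_eq_iff mat_def axis_def)
  then show ?thesis by (simp add: flow_jacobian_def)
qed

lemma continuous_on_flow_jacobian: "continuous_on {0..T} (\<lambda>t. flow_jacobian T v A t x)"
  unfolding flow_jacobian_def
  by (rule continuous_on_det)
    (auto intro!: continuous_on_component lipschitz_field.continuous_on_flow[OF variational_field])

text \<open>The matrix M of DX satisfies M' = B M, where B is the matrix of A along the trajectory,
  so Jacobi's formula applies. The trace of B is written as a sum over \<open>Basis\<close>, the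
  shape in which the divergence of the field occurs.\<close>

lemma flow_jacobian_has_derivative:
  assumes t: "t \<in> {0<..<T}"
  shows "((\<lambda>t. flow_jacobian T v A t x) has_real_derivative
           (\<Sum>b\<in>Basis. A t (ode_flow T v t x) b \<bullet> b) * flow_jacobian T v A t x) (at t)"
proof -
  have t': "t \<in> {0..T}" using t by auto
  have at: "at t within {0..T} = at t" using t by (intro at_within_interior) auto
  define B where "B = (\<chi> i k :: 'n ranked. A t (ode_flow T v t x) (axis (unrank k) 1) $ unrank i)"
  define M where "M s = (\<chi> i j :: 'n ranked. flow_derivative s x (axis (unrank j) 1) $ unrank i)" for s
  have expand: "A t (ode_flow T v t x) h $ i =
      (\<Sum>k\<in>UNIV. A t (ode_flow T v t x) (axis (unrank k) 1) $ i * h $ unrank (k :: 'n ranked))" for h i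
  proof -
    have "A t (ode_flow T v t x) h = (\<Sum>k\<in>UNIV. h $ k *\<^sub>R A t (ode_flow T v t x) (axis k 1))"
      using linear_sum[OF linear_derivative[OF t'], of "ode_flow T v t x" "\<lambda>k. h $ k *\<^sub>R axis k 1" UNIV]
        linear_cmul[OF linear_derivative[OF t']] basis_expansion[of h]
      by (simp add: scalar_mult_eq_scaleR)
    then have "A t (ode_flow T v t x) h $ i = (\<Sum>k\<in>UNIV. A t (ode_flow T v t x) (axis k 1) $ i * h $ k)"
      by (simp add: mult.commute)
    also have "\<dots> = (\<Sum>k\<in>UNIV. A t (ode_flow T v t x) (axis (unrank k) 1) $ i * h $ unrank (k :: 'n ranked))"
      by (rule sum.reindex_bij_betw[OF bij_unrank, symmetric])
    finally show ?thesis .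
  qed
  have "((\<lambda>s. M s $ i $ j) has_real_derivative (B ** M t) $ i $ j) (at t)" for i j
  proof -
    have "((\<lambda>s. flow_derivative s x (axis (unrank j) 1)) has_vector_derivative
        A t (ode_flow T v t x) (flow_derivative t x (axis (unrank j) 1))) (at t)"
      using flow_derivative_vector_derivative[OF t'] unfolding at .
    then have "((\<lambda>s. flow_derivative s x (axis (unrank j) 1) $ unrank i) has_vector_derivative
        A t (ode_flow T v t x) (flow_derivative t x (axis (unrank j) 1)) $ unrank i) (at t)"
      by (rule bounded_linear.has_vector_derivative[OF bounded_linear_vec_nth])
    then show ?thesis
      by (subst (asm) expand)
        (simp add: M_def B_def matrix_matrix_mult_def has_real_derivative_iff_has_vector_derivative)
  qed
  then have "((\<lambda>s. det (M s)) has_real_derivative trace B * det (M t)) (at t)"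
    by (rule det_has_real_derivative)
  moreover have "trace B = (\<Sum>b\<in>Basis. A t (ode_flow T v t x) b \<bullet> b)"
  proof -
    have "trace B = (\<Sum>k\<in>UNIV. A t (ode_flow T v t x) (axis k 1) $ k)"
      unfolding trace_def B_def
      using sum.reindex_bij_betw[OF bij_unrank, of "\<lambda>k. A t (ode_flow T v t x) (axis k 1) $ k"] by simp
    also have "\<dots> = (\<Sum>b\<in>Basis. A t (ode_flow T v t x) b \<bullet> b)"
    proof -
      have "(Basis :: (real^'n) set) = (\<lambda>i. axis i 1) ` UNIV" by (auto simp: Basis_vec_def)
      moreover have "inj (\<lambda>i::'n. axis i (1::real))" by (auto simp: inj_def axis_eq_axis)
      ultimately show ?thesis by (subst sum.reindex_cong) (auto simp: inner_axis)
    qed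
    finally show ?thesis .
  qed
  ultimately show ?thesis by (simp add: flow_jacobian_def M_def)
qed

theorem distr_flow_continuity_equation:
  assumes nonneg: "\<And>t x. t \<in> {0..T} \<Longrightarrow> \<rho> t x \<ge> 0"
    and integrable: "\<And>t. t \<in> {0..T} \<Longrightarrow> integrable lborel (\<rho> t)"
    and cont: "\<And>x. continuous_on {0..T} (\<lambda>t. \<rho> t (ode_flow T v t x))"
    and transport: "\<And>t x. t \<in> {0<..<T} \<Longrightarrow> ((\<lambda>s. \<rho> s (ode_flow T v s x)) has_real_derivative
        - \<rho> t (ode_flow T v t x) * (\<Sum>b\<in>Basis. A t (ode_flow T v t x) b \<bullet> b)) (at t)"
    and t: "t \<in> {0..T}"
  shows "distr (density lborel (\<rho> 0)) borel (ode_flow T v t) = density lborel (\<rho> t)"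
proof -
  have zero: "0 \<in> {0..T}" using T_nonneg by simp
  interpret rev: C1_field t L "\<lambda>s x. - v (t - s) x" "\<lambda>s x h. - A (t - s) x h"
    by (rule reverse_C1_field[OF t])
  \<comment> \<open>t = 0 is treated apart because constancy is argued on a nondegenerate interval:
    zero derivative inside, continuity at the ends.\<close>
  have const: "\<rho> t (ode_flow T v t x) * flow_jacobian T v A t x = \<rho> 0 x" for x
  proof (cases "t = 0")
    case False
    let ?q = "\<lambda>t. \<rho> t (ode_flow T v t x) * flow_jacobian T v A t x"
    have "?q t = ?q 0"
    proof (rule DERIV_isconst_end[of 0 t ?q])
      show "0 < t" using t False by simp
      show "continuous_on {0..t} ?q"
        using t by (intro continuous_on_mult continuous_on_subset[OF cont]
            continuous_on_subset[OF continuous_on_flow_jacobian]) auto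
      fix s assume "0 < s" "s < t"
      then have s: "s \<in> {0<..<T}" using t by auto
      show "DERIV ?q s :> 0"
        by (rule DERIV_cong[OF DERIV_mult[OF transport[OF s] flow_jacobian_has_derivative[OF s]]])
          (simp add: algebra_simps)
    qed
    then show ?thesis by simp
  qed simp
  show ?thesis
  proof (rule distr_density_change_of_variables)
    show "(ode_flow T v t has_derivative flow_derivative t x) (at x)" for x
      by (rule flow_has_derivative[OF t])
    show "(ode_flow t (\<lambda>s x. - v (t - s) x) t has_derivative rev.flow_derivative t y) (at y)" for y
      by (rule rev.flow_has_derivative) (use t in simp)
    show "ode_flow t (\<lambda>s x. - v (t - s) x) t (ode_flow T v t x) = x" for x
      by (rule reverse_flow[OF t])
    show "ode_flow T v t (ode_flow t (\<lambda>s x. - v (t - s) x) t y) = y" for y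
      by (rule flow_reverse[OF t])
    show "integrable lborel (\<rho> t)" "\<rho> 0 \<in> borel_measurable borel"
      using integrable[OF t] integrable[OF zero] by auto
    show "\<rho> t x \<ge> 0" for x by (rule nonneg[OF t])
    show "\<rho> 0 x = \<bar>det (\<chi> i j :: 'n ranked. flow_derivative t x (axis (unrank j) 1) $ unrank i)\<bar>
        * \<rho> t (ode_flow T v t x)" for x
    proof -
      \<comment> \<open>Taking absolute values of the conserved product introduces the absolute
        determinant at once, without determining its sign.\<close>
      have "\<rho> 0 x = \<bar>\<rho> t (ode_flow T v t x) * flow_jacobian T v A t x\<bar>"
        using nonneg[OF zero, of x] by (simp add: const)
      then show ?thesis
        using nonneg[OF t] by (simp add: flow_jacobian_def abs_mult mult.commute)
    qed
  qed
qed

end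

section \<open>The spaces of the Madelung problem\<close>

text \<open>Two halves of e: uniform convergence in time on the unit ball around x, and spatial
  continuity at the fixed time t.\<close>

lemma C_time_space_0_0_continuous_on:
  fixes f :: "real \<Rightarrow> 'a::euclidean_space \<Rightarrow> 'b::real_normed_vector"
  assumes "C_time_space 0 0 T f"
  shows "continuous_on ({0..T} \<times> UNIV) (\<lambda>(t, x). f t x)"
  unfolding continuous_on_iff
proof (intro ballI allI impI)
  fix p :: "real \<times> 'a" and e :: real assume "p \<in> {0..T} \<times> UNIV" and "e > 0"
  then obtain t x where p: "p = (t, x)" and t: "t \<in> {0..T}" by blast
  have "uniform_limit (cball x 1) f (f t) (at t within {0..T})" and "continuous_on UNIV (f t)"
    using assms t by auto
  have "\<forall>\<^sub>F s in at t within {0..T}. \<forall>y\<in>cball x 1. dist (f s y) (f t y) < e / 2"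
    using \<open>e > 0\<close> by (intro uniform_limitD[OF \<open>uniform_limit _ _ _ _\<close>]) simp
  \<comment> \<open>The filter leaves out s = t, where the distance is 0.\<close>
  then obtain d where "d > 0" and d: "\<And>s y. s \<in> {0..T} \<Longrightarrow> dist s t < d \<Longrightarrow> y \<in> cball x 1 \<Longrightarrow>
      dist (f s y) (f t y) < e / 2"
    unfolding eventually_at using \<open>e > 0\<close> by (metis dist_self half_gt_zero)
  obtain d' where "d' > 0" and d': "\<And>y. dist y x < d' \<Longrightarrow> dist (f t y) (f t x) < e / 2"
    using \<open>continuous_on UNIV (f t)\<close> \<open>e > 0\<close> unfolding continuous_on_iff
    by (metis UNIV_I half_gt_zero)
  show "\<exists>d>0. \<forall>q\<in>{0..T} \<times> UNIV. dist q p < d \<longrightarrow>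
      dist (case q of (t, x) \<Rightarrow> f t x) (case p of (t, x) \<Rightarrow> f t x) < e"
  proof (intro exI[of _ "min 1 (min d d')"] conjI ballI impI)
    fix q :: "real \<times> 'a" assume "q \<in> {0..T} \<times> UNIV" and less: "dist q p < min 1 (min d d')"
    then obtain s y where q: "q = (s, y)" and s: "s \<in> {0..T}" by blast
    have "dist s t < d" "dist y x < d'" "dist y x < 1"
      using less dist_fst_le[of q p] dist_snd_le[of q p] by (auto simp: p q)
    then have "dist (f s y) (f t y) < e / 2" "dist (f t y) (f t x) < e / 2"
      using d[OF s, of y] d'[of y] by (auto simp: dist_commute)
    then show "dist (case q of (t, x) \<Rightarrow> f t x) (case p of (t, x) \<Rightarrow> f t x) < e"
      using dist_triangle[of "f s y" "f t x" "f t y"] by (simp add: p q)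
  qed (use \<open>d > 0\<close> \<open>d' > 0\<close> in auto)
qed

lemma C_time_space_partial_deriv:
  assumes "C_time_space 0 (Suc l) T f" "i \<in> Basis"
  shows "C_time_space 0 l T (\<lambda>t. partial_deriv i (f t))"
  using assms by simp

lemma C_time_space_0_continuous_on:
  assumes "C_time_space 0 l T f"
  shows "continuous_on ({0..T} \<times> UNIV) (\<lambda>(t, x). f t x)"
proof (rule C_time_space_0_0_continuous_on)
  show "C_time_space 0 0 T f"
    using assms by (cases l) (auto intro: differentiable_imp_continuous_on)
qed

text \<open>The transport term appears as \<open>f' (F x)\<close> because the chain rule along a
  trajectory yields it in the same shape.\<close>

lemma divergence_scaleR:
  assumes f: "(f has_derivative f') (at x)" and F: "(F has_derivative F') (at x)"
  shows "divergence (\<lambda>y. f y *\<^sub>R F y) x = f' (F x) + f x * (\<Sum>i\<in>Basis. F' i \<bullet> i)"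
proof -
  have "partial_deriv i (\<lambda>y. (f y *\<^sub>R F y) \<bullet> i) x = f' i * (F x \<bullet> i) + f x * (F' i \<bullet> i)" for i
  proof -
    have "((\<lambda>y. (f y *\<^sub>R F y) \<bullet> i) has_derivative (\<lambda>h. f' h * (F x \<bullet> i) + f x * (F' h \<bullet> i))) (at x)"
      by (auto intro!: derivative_eq_intros f F simp: algebra_simps)
    then show ?thesis
      unfolding partial_deriv_def by (simp add: frechet_derivative_at[symmetric])
  qed
  then have "divergence (\<lambda>y. f y *\<^sub>R F y) x = (\<Sum>i\<in>Basis. f' i * (F x \<bullet> i)) + f x * (\<Sum>i\<in>Basis. F' i \<bullet> i)"
    by (simp add: divergence_def sum.distrib sum_distrib_left)
  also have "(\<Sum>i\<in>Basis. f' i * (F x \<bullet> i)) = f' (F x)"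
    using linear_sum[OF has_derivative_linear[OF f], of "\<lambda>i. (F x \<bullet> i) *\<^sub>R i" Basis]
      linear_cmul[OF has_derivative_linear[OF f]]
    by (simp add: euclidean_representation mult.commute)
  finally show ?thesis .
qed

lemma tendsto_uniform_limit_compose:
  fixes f :: "'t \<Rightarrow> 'a \<Rightarrow> 'b::metric_space"
  assumes unif: "uniform_limit K f l F" and ev: "\<forall>\<^sub>F s in F. X s \<in> K"
    and lim: "((\<lambda>s. l (X s)) \<longlongrightarrow> L) F"
  shows "((\<lambda>s. f s (X s)) \<longlongrightarrow> L) F"
proof (rule tendstoI)
  fix e :: real assume "e > 0"
  then have "e / 2 > 0" by simp
  then have "\<forall>\<^sub>F s in F. \<forall>y\<in>K. dist (f s y) (l y) < e / 2" "\<forall>\<^sub>F s in F. dist (l (X s)) L < e / 2"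
    by (rule uniform_limitD[OF unif], rule tendstoD[OF lim])
  with ev show "\<forall>\<^sub>F s in F. dist (f s (X s)) L < e"
  proof eventually_elim
    case (elim s)
    then have "dist (f s (X s)) (l (X s)) < e / 2" by blast
    with elim(3) show ?case using dist_triangle[of "f s (X s)" L "l (X s)"] by linarith
  qed
qed

text \<open>The increment splits into one in time at the moving point \<open>X s\<close> and one in
  space at the fixed time t. The first quotient converges because time quotients converge uniformly
  on a ball around \<open>X t\<close> to a continuous limit; the second is the ordinary chain
  rule.\<close>

lemma has_real_derivative_along_curve:
  fixes f :: "real \<Rightarrow> 'a::euclidean_space \<Rightarrow> real"
  assumes f: "C_time_space 1 0 T f" and t: "t \<in> {0<..<T}"
    and der: "(f t has_derivative f') (at (X t))"
    and X: "(X has_vector_derivative w) (at t)"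
  shows "((\<lambda>s. f s (X s)) has_real_derivative deriv (\<lambda>s. f s (X t)) t + f' w) (at t)"
proof -
  have t': "t \<in> {0..T}" using t by auto
  have at: "at t within {0..T} = at t" using t by (intro at_within_interior) auto
  obtain g where g: "C_time_space 0 0 T g" "\<And>t K. t \<in> {0..T} \<Longrightarrow> compact K \<Longrightarrow>
      uniform_limit K (\<lambda>s x. (f s x - f t x) /\<^sub>R (s - t)) (g t) (at t within {0..T})"
    using f by auto
  have unif: "uniform_limit K (\<lambda>s x. (f s x - f t x) / (s - t)) (g t) (at t)" if "compact K" for K
    using g(2)[OF t' that] unfolding at by (simp add: divide_inverse mult.commute)
  \<comment> \<open>At a fixed point the locally uniform limit is the classical derivative, that is,
    the \<open>deriv\<close> of the Madelung equations.\<close>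
  have "((\<lambda>s. (f s (X t) - f t (X t)) / (s - t)) \<longlongrightarrow> g t (X t)) (at t)"
    using unif[of "{X t}"] by (rule tendsto_uniform_limitI) auto
  then have "((\<lambda>s. f s (X t)) has_real_derivative g t (X t)) (at t)"
    by (simp add: has_field_derivative_iff)
  then have deriv: "deriv (\<lambda>s. f s (X t)) t = g t (X t)" by (rule DERIV_imp_deriv)
  have lim_X: "(X \<longlongrightarrow> X t) (at t)"
    using has_vector_derivative_continuous[OF X] by (simp add: continuous_within)
  have "((\<lambda>s. (f s (X s) - f t (X s)) / (s - t)) \<longlongrightarrow> g t (X t)) (at t)"
  proof (rule tendsto_uniform_limit_compose[OF unif[of "cball (X t) 1"]])
    show "\<forall>\<^sub>F s in at t. X s \<in> cball (X t) 1"
      using tendstoD[OF lim_X, of 1] by (auto elim!: eventually_mono simp: dist_commute)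
    have "isCont (g t) (X t)"
      using g(1) t' by (simp add: continuous_on_eq_continuous_at)
    then show "((\<lambda>s. g t (X s)) \<longlongrightarrow> g t (X t)) (at t)"
      using lim_X by (rule isCont_tendsto_compose)
  qed simp
  moreover have "((\<lambda>s. (f t (X s) - f t (X t)) / (s - t)) \<longlongrightarrow> f' w) (at t)"
  proof -
    have "((\<lambda>s. f t (X s)) has_derivative (\<lambda>h. f' (h *\<^sub>R w))) (at t)"
      using has_derivative_compose[OF X[unfolded has_vector_derivative_def] der] .
    moreover have "(\<lambda>h. f' (h *\<^sub>R w)) = (*) (f' w)"
      using linear_cmul[OF has_derivative_linear[OF der]] by (auto simp: mult.commute)
    ultimately have "((\<lambda>s. f t (X s)) has_real_derivative f' w) (at t)"
      by (simp add: has_field_derivative_def)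
    then show ?thesis by (simp add: has_field_derivative_iff)
  qed
  ultimately have "((\<lambda>s. (f s (X s) - f t (X s)) / (s - t) + (f t (X s) - f t (X t)) / (s - t))
      \<longlongrightarrow> g t (X t) + f' w) (at t)"
    by (rule tendsto_add)
  then have "((\<lambda>s. (f s (X s) - f t (X t)) / (s - t)) \<longlongrightarrow> g t (X t) + f' w) (at t)"
    by (simp flip: add_divide_distrib)
  then show ?thesis by (simp add: has_field_derivative_iff deriv)
qed

section \<open>The Madelung flow\<close>

text \<open>The Hessian of \<open>\<theta> t\<close> divided by m, as a linear map acting on
  h.\<close>

definition velocity_derivative ::
    "real \<Rightarrow> (real \<Rightarrow> 'a::euclidean_space \<Rightarrow> real) \<Rightarrow> real \<Rightarrow> 'a \<Rightarrow> 'a \<Rightarrow> 'a" where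
  "velocity_derivative m \<theta> t x h =
     (1 / m) *\<^sub>R (\<Sum>i\<in>Basis. frechet_derivative (partial_deriv i (\<theta> t)) (at x) h *\<^sub>R i)"

lemma grad_has_derivative:
  assumes "C_space 2 f"
  shows "(grad f has_derivative (\<lambda>h. \<Sum>i\<in>Basis. frechet_derivative (partial_deriv i f) (at x) h *\<^sub>R i)) (at x)"
proof -
  have "(partial_deriv i f has_derivative frechet_derivative (partial_deriv i f) (at x)) (at x)"
    if "i \<in> Basis" for i
  proof -
    have "partial_deriv i f differentiable (at x)"
      using assms that by (simp add: numeral_2_eq_2 differentiable_on_def)
    then show ?thesis by (simp flip: frechet_derivative_works)
  qed
  then have "((\<lambda>y. \<Sum>i\<in>Basis. partial_deriv i f y *\<^sub>R i) has_derivative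
      (\<lambda>h. \<Sum>i\<in>Basis. frechet_derivative (partial_deriv i f) (at x) h *\<^sub>R i)) (at x)"
    by (intro has_derivative_sum has_derivative_scaleR_left)
  moreover have "grad f = (\<lambda>y. \<Sum>i\<in>Basis. partial_deriv i f y *\<^sub>R i)"
    by (simp add: fun_eq_iff grad_def)
  ultimately show ?thesis by simp
qed

text \<open>Locally uniform convergence in time of the first and second spatial derivatives of
  \<open>\<theta>\<close> makes them jointly continuous: the first give the field, the second its
  derivative.\<close>

lemma velocity_C1_field:
  assumes \<theta>: "C_time_space 0 2 T \<theta>" and "0 \<le> T" "0 \<le> L"
    and lip: "\<And>t x y. t \<in> {0..T} \<Longrightarrow>
      norm (velocity m \<theta> t x - velocity m \<theta> t y) \<le> L * norm (x - y)"
  shows "C1_field T L (velocity m \<theta>) (velocity_derivative m \<theta>)"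
proof
  have \<theta>1: "C_time_space 0 1 T (\<lambda>t. partial_deriv i (\<theta> t))" if "i \<in> Basis" for i
    using C_time_space_partial_deriv[of 1 T \<theta> i] \<theta> that by (simp add: numeral_2_eq_2)
  have cont1: "continuous_on ({0..T} \<times> UNIV) (\<lambda>p. partial_deriv i (\<theta> (fst p)) (snd p))"
    if "i \<in> Basis" for i
    using C_time_space_0_continuous_on[OF \<theta>1[OF that]] by (simp add: case_prod_unfold)
  have cont2: "continuous_on ({0..T} \<times> UNIV)
      (\<lambda>p. frechet_derivative (partial_deriv i (\<theta> (fst p))) (at (snd p)) h)"
    if "i \<in> Basis" "h \<in> Basis" for i h
  proof -
    have "C_time_space 0 0 T (\<lambda>t. partial_deriv h (partial_deriv i (\<theta> t)))"
      using C_time_space_partial_deriv[of 0 T "\<lambda>t. partial_deriv i (\<theta> t)" h] \<theta>1[OF that(1)] that(2)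
      by simp
    from C_time_space_0_continuous_on[OF this] show ?thesis
      by (simp add: case_prod_unfold partial_deriv_def[of h])
  qed
  show "continuous_on ({0..T} \<times> UNIV) (\<lambda>(t, x). velocity m \<theta> t x)"
    unfolding velocity_def grad_def case_prod_unfold by (intro continuous_intros cont1)
  show "(velocity m \<theta> t has_derivative velocity_derivative m \<theta> t x) (at x)" if "t \<in> {0..T}" for t x
  proof -
    have "C_space 2 (\<theta> t)" using \<theta> that by simp
    then have "((\<lambda>y. (1 / m) *\<^sub>R grad (\<theta> t) y) has_derivative (\<lambda>h. velocity_derivative m \<theta> t x h)) (at x)"
      unfolding velocity_derivative_def by (intro has_derivative_scaleR_right grad_has_derivative)
    then show ?thesis by (simp add: velocity_def[abs_def])
  qed
  show "continuous_on ({0..T} \<times> UNIV) (\<lambda>(t, x). velocity_derivative m \<theta> t x h)" if "h \<in> Basis" for h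
    using that unfolding velocity_derivative_def case_prod_unfold
    by (intro continuous_intros cont2)
qed (use assms in auto)

text \<open>With f' the spatial derivative of the density, the continuity equation expands to -
  f'(v) - \<rho> div v for the time derivative. The chain rule along the trajectory adds f'(v),
  which cancels.\<close>

lemma madelung_transport:
  assumes sol: "classical_madelung_solution m T \<rho>0 \<theta>0 \<rho> \<theta>" and t: "t \<in> {0<..<T}"
    and X: "(X has_vector_derivative velocity m \<theta> t (X t)) (at t)"
  shows "((\<lambda>s. \<rho> s (X s)) has_real_derivative
           - \<rho> t (X t) * (\<Sum>b\<in>Basis. velocity_derivative m \<theta> t (X t) b \<bullet> b)) (at t)"
proof -
  have t': "t \<in> {0..T}" using t by simp
  have \<rho>: "C_time_space 1 0 T \<rho>" "C_time_space 0 2 T \<rho>" and \<theta>: "C_space 2 (\<theta> t)"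
    and eq: "madelung_equations m T \<rho> \<theta>"
    using sol t' by (auto simp: classical_madelung_solution_def)
  define f' where "f' = frechet_derivative (\<rho> t) (at (X t))"
  have "\<rho> t differentiable (at (X t))"
    using \<rho>(2) t' by (simp add: numeral_2_eq_2 differentiable_on_def)
  then have f': "(\<rho> t has_derivative f') (at (X t))"
    by (simp add: f'_def flip: frechet_derivative_works)
  have "deriv (\<lambda>s. \<rho> s (X t)) t = - (1 / m) * divergence (\<lambda>y. \<rho> t y *\<^sub>R grad (\<theta> t) y) (X t)"
    using eq t unfolding madelung_equations_def by (simp add: add_eq_0_iff2)
  also have "\<dots> = - f' (velocity m \<theta> t (X t)) - \<rho> t (X t) * (\<Sum>b\<in>Basis. velocity_derivative m \<theta> t (X t) b \<bullet> b)"
  proof -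
    have "f' (velocity m \<theta> t (X t)) = (1 / m) * f' (grad (\<theta> t) (X t))"
      using linear_cmul[OF has_derivative_linear[OF f']] by (simp add: velocity_def)
    moreover have "(\<Sum>b\<in>Basis. velocity_derivative m \<theta> t (X t) b \<bullet> b) = (1 / m) *
        (\<Sum>b\<in>Basis. (\<Sum>i\<in>Basis. frechet_derivative (partial_deriv i (\<theta> t)) (at (X t)) b *\<^sub>R i) \<bullet> b)"
      by (simp add: velocity_derivative_def sum_distrib_left)
    ultimately show ?thesis
      unfolding divergence_scaleR[OF f' grad_has_derivative[OF \<theta>]] by (simp add: algebra_simps)
  qed
  finally show ?thesis
    using has_real_derivative_along_curve[OF \<rho>(1) t f' X] by simp
qed

lemma prob_density_measure:
  assumes "prob_density f"
  shows "density_measure f \<in> space (prob_algebra borel)"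
proof -
  have f: "\<And>x. 0 \<le> f x" "integrable lborel f" "(\<integral>x. f x \<partial>lborel) = 1"
    using assms by (auto simp: prob_density_def)
  then have "(\<integral>\<^sup>+x. ennreal (f x) \<partial>lborel) = 1"
    by (subst nn_integral_eq_integral) auto
  then have "prob_space (density_measure f)"
    using f(2) by (intro prob_spaceI) (simp add: density_measure_def emeasure_density)
  then show ?thesis by (simp add: space_prob_algebra density_measure_def)
qed

theorem proposition2p3:
  fixes m T :: real
    and \<rho>0 \<theta>0 :: "real ^ 'd \<Rightarrow> real"
    and \<rho> \<theta> :: "real \<Rightarrow> real ^ 'd \<Rightarrow> real"
  assumes "m > 0" and "T > 0"
    and "\<forall>x. \<rho>0 x > 0" and "prob_density \<rho>0"
    and "unique_classical_madelung_solution m T \<rho>0 \<theta>0 \<rho> \<theta>"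
    and "\<forall>t\<in>{0..T}. \<forall>x. \<rho> t x > 0"
    and "\<exists>L>0. \<forall>t\<in>{0..T}. \<forall>x y.
           norm (velocity m \<theta> t x - velocity m \<theta> t y) \<le> L * norm (x - y)"
    and "\<exists>C>0. \<forall>t\<in>{0..T}. \<forall>x. norm (velocity m \<theta> t x) \<le> C * (1 + norm x)"
  shows "\<exists>X. characteristic_flow T (velocity m \<theta>) X \<and>
           (\<forall>Y. characteristic_flow T (velocity m \<theta>) Y \<longrightarrow>
              (\<forall>t\<in>{0..T}. \<forall>x. Y t x = X t x)) \<and>
           (\<forall>t\<in>{0..T}.
              C1_diffeomorphism (X t) \<and>
              density_measure (\<rho> t) \<in> space (prob_algebra borel) \<and>
              density_measure (\<rho> t) = distr (density_measure \<rho>0) borel (X t)) \<and>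
           (\<forall>(M :: 'w measure) X0.
              prob_space M \<and> X0 \<in> borel_measurable M \<and>
              distr M borel X0 = density_measure \<rho>0 \<longrightarrow>
              (\<forall>t\<in>{0..T}.
                 (\<lambda>\<omega>. X t (X0 \<omega>)) \<in> borel_measurable M \<and>
                 distr M borel (\<lambda>\<omega>. X t (X0 \<omega>)) = density_measure (\<rho> t)))"
proof -
  have sol: "classical_madelung_solution m T \<rho>0 \<theta>0 \<rho> \<theta>"
    using assms(5) by (simp add: unique_classical_madelung_solution_def)
  then have \<rho>: "C_time_space 0 2 T \<rho>" and \<theta>: "C_time_space 0 2 T \<theta>"
    and dens: "\<And>t. t \<in> {0..T} \<Longrightarrow> prob_density (\<rho> t)" and init: "\<rho> 0 = \<rho>0"
    by (auto simp: classical_madelung_solution_def)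
  define v where "v = velocity m \<theta>"
  obtain L where "L > 0" and L: "\<And>t x y. t \<in> {0..T} \<Longrightarrow>
      norm (velocity m \<theta> t x - velocity m \<theta> t y) \<le> L * norm (x - y)"
    using assms(7) by auto
  then have C1: "C1_field T L v (velocity_derivative m \<theta>)"
    unfolding v_def using \<theta> \<open>T > 0\<close> by (intro velocity_C1_field) auto
  interpret C1_field T L v "velocity_derivative m \<theta>" by (rule C1)
  define X where "X = ode_flow T v"
  have flow: "characteristic_flow T v X"
    unfolding characteristic_flow_iff X_def using flow_solution by simp
  have unique: "Y t x = X t x" if "characteristic_flow T v Y" "t \<in> {0..T}" for Y t x
    using that flow_unique[of "\<lambda>t. Y t x" t] by (simp add: characteristic_flow_iff X_def)
  \<comment> \<open>The initial condition replaces \<open>\<rho>0\<close> by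
    \<open>\<rho> 0\<close>, the starting density of the transport theorem.\<close>
  have push: "distr (density_measure \<rho>0) borel (X t) = density_measure (\<rho> t)" if t: "t \<in> {0..T}" for t
    unfolding density_measure_def X_def init[symmetric]
  proof (rule distr_flow_continuity_equation[OF C1 _ _ _ _ t])
    show "\<rho> t x \<ge> 0" "integrable lborel (\<rho> t)" if "t \<in> {0..T}" for t x
      using dens[OF that] by (auto simp: prob_density_def)
    show "continuous_on {0..T} (\<lambda>t. \<rho> t (ode_flow T v t x))" for x
      using continuous_on_compose2[OF C_time_space_0_continuous_on[OF \<rho>]
          continuous_on_Pair[OF continuous_on_id continuous_on_flow[of x]]]
      by auto
    fix t x assume t: "t \<in> {0<..<T}"
    have "((\<lambda>s. ode_flow T v s x) has_vector_derivative v t (ode_flow T v t x)) (at t)"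
      using flow t by (simp add: characteristic_flow_def X_def)
    then show "((\<lambda>s. \<rho> s (ode_flow T v s x)) has_real_derivative - \<rho> t (ode_flow T v t x) *
        (\<Sum>b\<in>Basis. velocity_derivative m \<theta> t (ode_flow T v t x) b \<bullet> b)) (at t)"
      unfolding v_def by (rule madelung_transport[OF sol t])
  qed
  have diffeo: "C1_diffeomorphism (X t)" if "t \<in> {0..T}" for t
    unfolding X_def by (rule flow_C1_diffeomorphism[OF that])
  have meas: "X t \<in> borel_measurable borel" if "t \<in> {0..T}" for t
    using diffeo[OF that]
    by (auto simp: C1_diffeomorphism_def intro!: borel_measurable_continuous_onI differentiable_imp_continuous_on)
  \<comment> \<open>Image measures compose, so the law of X(t; X0) is the push-forward of the law of
    \<open>X0\<close>.\<close>
  have rv: "(\<lambda>\<omega>. X t (X0 \<omega>)) \<in> borel_measurable M \<and>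
      distr M borel (\<lambda>\<omega>. X t (X0 \<omega>)) = density_measure (\<rho> t)"
    if "X0 \<in> borel_measurable M" "distr M borel X0 = density_measure \<rho>0" "t \<in> {0..T}"
    for M :: "'w measure" and X0 t
    using measurable_compose[OF that(1) meas[OF that(3)]]
      distr_distr[OF meas[OF that(3)] that(1)] push[OF that(3)] that(2)
    by (simp add: o_def)
  show ?thesis
    unfolding v_def[symmetric]
  proof (intro exI[of _ X] conjI allI impI ballI)
    fix M :: "'w measure" and X0 :: "'w \<Rightarrow> real^'d" and t
    assume M: "prob_space M \<and> X0 \<in> borel_measurable M \<and> distr M borel X0 = density_measure \<rho>0"
      and t: "t \<in> {0..T}"
    from M t show "(\<lambda>\<omega>. X t (X0 \<omega>)) \<in> borel_measurable M"
        "distr M borel (\<lambda>\<omega>. X t (X0 \<omega>)) = density_measure (\<rho> t)"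
      using rv[of X0 M t] by blast+
  qed (fact flow unique diffeo prob_density_measure[OF dens] push[symmetric])+
qed

end
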